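(* Let $k,l,r,s\in\mathbb Z_+$. The set of monomials $\{t^{\mathbf m}\mid\mathbf m\in\mathfrak M^{k|l}_{r|s}\}$ constitutes a $\mathcal K$-basis for $\mathcal M^{k|l}_{r|s}$.
   Context: $\mathcal K=\mathbb C(q)$, $q$ an indeterminate; $\mathbb Z_+=\{0,1,2,\dots\}$. For $m,n\in\mathbb Z_+$, $\mathbf I_{m|n}=\{1,\dots,m+n\}$ with parity $[a]=\bar0$ for $a\le m$ and $[a]=\bar1$ for $a>m$ (the parity of an index is taken in the index set it belongs to), $q_a=q^{(-1)^{[a]}}$. $\mathcal M^{k|l}_{r|s}$ is the unital associative $\mathcal K$-superalgebra generated by $t_{ab}$ ($a\in\mathbf I_{k|l}$, $b\in\mathbf I_{r|s}$), $[t_{ab}]=[a]+[b]$, with relations: $(t_{ab})^2=0$ if $[a]+[b]=\bar1$; $t_{ac}t_{bc}=(-1)^{([a]+[c])([b]+[c])}q_ct_{bc}t_{ac}$ ($a>b$); $t_{ab}t_{ac}=(-1)^{([a]+[c])([a]+[b])}q_at_{ac}t_{ab}$ ($b>c$); $t_{ac}t_{bd}=(-1)^{([a]+[c])([b]+[d])}t_{bd}t_{ac}$ ($a>b$, $c<d$); $t_{ac}t_{bd}=(-1)^{([a]+[c])([b]+[d])}t_{bd}t_{ac}+(-1)^{[a]([b]+[d])+[b][d]}(q-q^{-1})t_{bc}t_{ad}$ ($a>b$, $c>d$). $\mathfrak M^{k|l}_{r|s}$ is the set of $(k+l)\times(r+s)$ matrices $\mathbf m=(m_{ab})_{a\in\mathbf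 I_{k|l},b\in\mathbf I_{r|s}}$ with $m_{ab}\in\mathbb Z_+$ if $[a]+[b]=\bar0$ and $m_{ab}\in\{0,1\}$ if $[a]+[b]=\bar1$. For $\mathbf m\in\mathfrak M^{k|l}_{r|s}$, $t^{\mathbf m}=t_{11}^{m_{11}}t_{21}^{m_{21}}\cdots t_{12}^{m_{12}}t_{22}^{m_{22}}\cdots$, the factors $t_{ab}^{m_{ab}}$ being arranged column by column ($b$ increasing) and within a column with $a$ increasing. *)

theory Defs
  imports
    "HOL-Library.Poly_Mapping"
    "HOL-Computational_Algebra.Fraction_Field"
    "HOL-Computational_Algebra.Polynomial"
    "HOL-Algebra.QuotRing"
    "Jordan_Normal_Form.VS_Connect"
begin

hide_const (open) Polynomial.smult Modules.module Vector_Spaces.vector_space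

text \<open>
  The free algebra on letters of type \<open>'x\<close> is the monoid algebra of the free monoid.
  Convolution of \<^typ>\<open>'a \<Rightarrow>\<^sub>0 'b\<close> uses the additive monoid structure of \<open>'a\<close>, so words get a
  type of their own on which \<open>+\<close> is (noncommutative) concatenation.
\<close>

datatype 'x free_word = Word (letters: "'x list")

instantiation free_word :: (type) monoid_add
begin

definition zero_free_word :: "'a free_word" where
  "0 = Word []"

definition plus_free_word :: "'a free_word \<Rightarrow> 'a free_word \<Rightarrow> 'a free_word" where
  "v + w = Word (letters v @ letters w)"

instance
  by standard (simp_all add: zero_free_word_def plus_free_word_def)

end

abbreviation scale :: "'k::comm_ring_1 \<Rightarrow> ('x free_word \<Rightarrow>\<^sub>0 'k) \<Rightarrow> ('x free_word \<Rightarrow>\<^sub>0 'k)"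
    (infixr \<open>*\<^sub>K\<close> 75) where
  "c *\<^sub>K p \<equiv> Poly_Mapping.map ((*) c) p"

definition free_algebra :: "'x set \<Rightarrow> ('k::comm_ring_1, 'x free_word \<Rightarrow>\<^sub>0 'k) module" where
  "free_algebra X =
    \<lparr>carrier = {p. \<forall>w \<in> Poly_Mapping.keys p. set (letters w) \<subseteq> X},
     mult = (*), one = 1, zero = 0, add = (+), smult = (\<lambda>c p. c *\<^sub>K p)\<rparr>"

text \<open>Scalar multiplication on cosets, \<open>c \<odot> (I + x) = I + c \<odot> x\<close>, in the style of
  \<^const>\<open>rcoset_mult\<close>.\<close>

definition quotient_algebra ::
    "('k, 'a, 'm) module_scheme \<Rightarrow> 'a set \<Rightarrow> ('k, 'a set) module" where
  "quotient_algebra A I =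
    ring.extend (A Quot I)
      (module.fields (\<lambda>c Y. \<Union>y\<in>Y. I +>\<^bsub>A\<^esub> (c \<odot>\<^bsub>A\<^esub> y)))"

definition presented_algebra ::
    "'x set \<Rightarrow> ('x free_word \<Rightarrow>\<^sub>0 'k::comm_ring_1) set \<Rightarrow> ('k, ('x free_word \<Rightarrow>\<^sub>0 'k) set) module" where
  "presented_algebra X S =
    quotient_algebra (free_algebra X) (Idl\<^bsub>free_algebra X :: ('k, _) module\<^esub> S)"

type_synonym ratfun = "complex poly fract"

definition q :: ratfun where
  "q = Fract [:0, 1:] 1"

definition index_set :: "nat \<Rightarrow> nat \<Rightarrow> nat set" where
  "index_set m n = {1..m + n}"

text \<open>The parity of an index of \<open>index_set m n\<close> is determined by \<open>m\<close>; it is represented by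
  \<open>0\<close> or \<open>1\<close> in \<^typ>\<open>nat\<close>, and sums of parities are only used through \<^const>\<open>even\<close>/\<^const>\<open>odd\<close>
  and as exponents of \<open>-1\<close>.\<close>

definition parity :: "nat \<Rightarrow> nat \<Rightarrow> nat" where
  "parity m a = (if a \<le> m then 0 else 1)"

definition q_index :: "nat \<Rightarrow> nat \<Rightarrow> ratfun" where
  "q_index m a = q powi ((- 1) ^ parity m a)"

definition gen :: "nat \<Rightarrow> nat \<Rightarrow> ((nat \<times> nat) free_word \<Rightarrow>\<^sub>0 ratfun)" where
  "gen a b = Poly_Mapping.single (Word [(a, b)]) 1"

text \<open>Row indices carry the parity of \<open>index_set k l\<close>, column indices that of \<open>index_set r s\<close>.
  All relations are homogeneous for the parity \<open>[a] + [b]\<close> of the generators.\<close>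

definition relations ::
    "nat \<Rightarrow> nat \<Rightarrow> nat \<Rightarrow> nat \<Rightarrow> ((nat \<times> nat) free_word \<Rightarrow>\<^sub>0 ratfun) set" where
  "relations k l r s =
    (let I = index_set k l; J = index_set r s; p = parity k; p' = parity r in
      {(gen a b)\<^sup>2 | a b. a \<in> I \<and> b \<in> J \<and> odd (p a + p' b)}
    \<union> {gen a c * gen b c
         - ((- 1) ^ ((p a + p' c) * (p b + p' c)) * q_index r c) *\<^sub>K (gen b c * gen a c)
        | a b c. a \<in> I \<and> b \<in> I \<and> c \<in> J \<and> a > b}
    \<union> {gen a b * gen a c
         - ((- 1) ^ ((p a + p' c) * (p a + p' b)) * q_index k a) *\<^sub>K (gen a c * gen a b)
        | a b c. a \<in> I \<and> b \<in> J \<and> c \<in> J \<and> b > c}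
    \<union> {gen a c * gen b d
         - (- 1) ^ ((p a + p' c) * (p b + p' d)) *\<^sub>K (gen b d * gen a c)
        | a b c d. a \<in> I \<and> b \<in> I \<and> c \<in> J \<and> d \<in> J \<and> a > b \<and> c < d}
    \<union> {gen a c * gen b d
         - ((- 1) ^ ((p a + p' c) * (p b + p' d)) *\<^sub>K (gen b d * gen a c)
            + ((- 1) ^ (p a * (p b + p' d) + p b * p' d) * (q - inverse q))
                *\<^sub>K (gen b c * gen a d))
        | a b c d. a \<in> I \<and> b \<in> I \<and> c \<in> J \<and> d \<in> J \<and> a > b \<and> c > d})"

definition M_alg ::
    "nat \<Rightarrow> nat \<Rightarrow> nat \<Rightarrow> nat \<Rightarrow> (ratfun, ((nat \<times> nat) free_word \<Rightarrow>\<^sub>0 ratfun) set) module" where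
  "M_alg k l r s = presented_algebra (index_set k l \<times> index_set r s) (relations k l r s)"

definition t_gen ::
    "nat \<Rightarrow> nat \<Rightarrow> nat \<Rightarrow> nat \<Rightarrow> nat \<Rightarrow> nat \<Rightarrow> ((nat \<times> nat) free_word \<Rightarrow>\<^sub>0 ratfun) set" where
  "t_gen k l r s a b =
    (let F = free_algebra (index_set k l \<times> index_set r s)
     in (Idl\<^bsub>F\<^esub> relations k l r s) +>\<^bsub>F\<^esub> gen a b)"

text \<open>Matrices are functions that vanish outside of the index range.\<close>

definition exponent_matrices :: "nat \<Rightarrow> nat \<Rightarrow> nat \<Rightarrow> nat \<Rightarrow> (nat \<Rightarrow> nat \<Rightarrow> nat) set" where
  "exponent_matrices k l r s =
    {m. (\<forall>a b. \<not> (a \<in> index_set k l \<and> b \<in> index_set r s) \<longrightarrow> m a b = 0) \<and>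
        (\<forall>a \<in> index_set k l. \<forall>b \<in> index_set r s.
           odd (parity k a + parity r b) \<longrightarrow> m a b \<in> {0, 1})}"

definition t_monomial ::
    "nat \<Rightarrow> nat \<Rightarrow> nat \<Rightarrow> nat \<Rightarrow> (nat \<Rightarrow> nat \<Rightarrow> nat) \<Rightarrow> ((nat \<times> nat) free_word \<Rightarrow>\<^sub>0 ratfun) set" where
  "t_monomial k l r s m =
    foldr (\<otimes>\<^bsub>M_alg k l r s\<^esub>)
      [t_gen k l r s a b [^]\<^bsub>M_alg k l r s\<^esub> m a b. b \<leftarrow> [1..<Suc (r + s)], a \<leftarrow> [1..<Suc (k + l)]]
      \<one>\<^bsub>M_alg k l r s\<^esub>"

lemma scale_conv_mult: "c *\<^sub>K p = Poly_Mapping.single 0 c * p"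
  for p :: "'x free_word \<Rightarrow>\<^sub>0 'k::comm_ring_1"
  by (rule mult_map_scale_conv_mult)

lemma scale_add_left: "(c + d) *\<^sub>K p = c *\<^sub>K p + d *\<^sub>K p"
  and scale_add_right: "c *\<^sub>K (p + p') = c *\<^sub>K p + c *\<^sub>K p'"
  and scale_scale: "(c * d) *\<^sub>K p = c *\<^sub>K (d *\<^sub>K p)"
  and scale_one: "1 *\<^sub>K p = p"
  for p p' :: "'x free_word \<Rightarrow>\<^sub>0 'k::comm_ring_1"
  by (simp_all add: scale_conv_mult single_add algebra_simps mult_single flip: mult.assoc)

lemma free_algebra_mult_closed:
  assumes "p \<in> carrier (free_algebra X)" "p' \<in> carrier (free_algebra X)"
  shows "p * p' \<in> carrier (free_algebra X)"
  using assms keys_mult[of p p'] by (fastforce simp: free_algebra_def plus_free_word_def)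

lemma free_algebra_scale_closed:
  assumes "p \<in> carrier (free_algebra X)"
  shows "c *\<^sub>K p \<in> carrier (free_algebra X)"
  unfolding scale_conv_mult
  by (rule free_algebra_mult_closed[OF _ assms]) (simp add: free_algebra_def zero_free_word_def)

lemma free_algebra_add_closed:
  assumes "p \<in> carrier (free_algebra X)" "p' \<in> carrier (free_algebra X)"
  shows "p + p' \<in> carrier (free_algebra X)"
  using assms Poly_Mapping.keys_add[of p p'] by (fastforce simp: free_algebra_def)

lemma free_algebra_uminus_closed:
  assumes "p \<in> carrier (free_algebra X)"
  shows "- p \<in> carrier (free_algebra X)"
  using assms by (simp add: free_algebra_def)

lemma free_algebra_diff_closed:
  assumes "p \<in> carrier (free_algebra X)" "p' \<in> carrier (free_algebra X)"
  shows "p - p' \<in> carrier (free_algebra X)"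
  using assms keys_diff[of p p'] by (fastforce simp: free_algebra_def)

lemma free_algebra_single_closed:
  assumes "set (letters w) \<subseteq> X"
  shows "Poly_Mapping.single w c \<in> carrier (free_algebra X)"
  using assms by (simp add: free_algebra_def)

lemma ring_free_algebra:
  fixes X :: "'x set"
  shows "ring (free_algebra X :: ('k::comm_ring_1, _) module)"
proof (rule ringI)
  show "abelian_group (free_algebra X :: ('k, _) module)"
  proof (rule abelian_groupI)
    fix p :: "'x free_word \<Rightarrow>\<^sub>0 'k" assume "p \<in> carrier (free_algebra X)"
    then have "- p \<in> carrier (free_algebra X)"
      by (rule free_algebra_uminus_closed)
    then show "\<exists>p'\<in>carrier (free_algebra X). p' \<oplus>\<^bsub>free_algebra X :: ('k, _) module\<^esub> p = \<zero>\<^bsub>free_algebra X :: ('k, _) module\<^esub>"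
      by (intro bexI[of _ "- p"]) (simp_all add: free_algebra_def)
  next
    fix p p' :: "'x free_word \<Rightarrow>\<^sub>0 'k"
    assume "p \<in> carrier (free_algebra X)" "p' \<in> carrier (free_algebra X)"
    then show "p \<oplus>\<^bsub>free_algebra X :: ('k, _) module\<^esub> p' \<in> carrier (free_algebra X)"
      using free_algebra_add_closed[of p X p'] by (simp add: free_algebra_def)
  qed (simp_all add: free_algebra_def algebra_simps)
  show "Group.monoid (free_algebra X :: ('k, _) module)"
  proof (rule monoidI)
    fix p p' :: "'x free_word \<Rightarrow>\<^sub>0 'k"
    assume "p \<in> carrier (free_algebra X)" "p' \<in> carrier (free_algebra X)"
    then show "p \<otimes>\<^bsub>free_algebra X :: ('k, _) module\<^esub> p' \<in> carrier (free_algebra X)"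
      using free_algebra_mult_closed[of p X p'] by (simp add: free_algebra_def)
  qed (simp_all add: free_algebra_def algebra_simps zero_free_word_def)
qed (simp_all add: free_algebra_def algebra_simps)

lemma
  fixes A :: "('k, 'a, 'm) module_scheme"
  shows carrier_quotient_algebra: "carrier (quotient_algebra A I) = carrier (A Quot I)"
    and mult_quotient_algebra: "mult (quotient_algebra A I) = mult (A Quot I)"
    and one_quotient_algebra: "one (quotient_algebra A I) = one (A Quot I)"
    and zero_quotient_algebra: "zero (quotient_algebra A I) = zero (A Quot I)"
    and add_quotient_algebra: "add (quotient_algebra A I) = add (A Quot I)"
    and smult_quotient_algebra:
      "smult (quotient_algebra A I) = (\<lambda>c Y. \<Union>y\<in>Y. I +>\<^bsub>A\<^esub> (c \<odot>\<^bsub>A\<^esub> y))"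
  by (simp_all add: quotient_algebra_def ring.defs module.defs)

lemmas quotient_algebra_simps =
  carrier_quotient_algebra mult_quotient_algebra one_quotient_algebra
  zero_quotient_algebra add_quotient_algebra smult_quotient_algebra

lemma ring_quotient_algebra:
  assumes "ideal I A"
  shows "ring (quotient_algebra A I)"
proof -
  interpret Q: ring "A Quot I"
    using assms by (rule ideal.quotient_is_ring)
  show ?thesis
  proof (rule ringI)
    show "abelian_group (quotient_algebra A I)"
    proof (rule abelian_groupI)
      fix Y assume "Y \<in> carrier (quotient_algebra A I)"
      then show "\<exists>Z\<in>carrier (quotient_algebra A I).
          Z \<oplus>\<^bsub>quotient_algebra A I\<^esub> Y = \<zero>\<^bsub>quotient_algebra A I\<^esub>"
        by (auto simp: quotient_algebra_simps intro!: bexI[of _ "\<ominus>\<^bsub>A Quot I\<^esub> Y"] Q.l_neg)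
    qed (simp_all add: quotient_algebra_simps Q.a_ac)
    show "Group.monoid (quotient_algebra A I)"
      by (rule monoidI) (auto simp: quotient_algebra_simps Q.m_assoc)
  qed (auto simp: quotient_algebra_simps Q.l_distr Q.r_distr)
qed

lemma smult_coset_free_algebra:
  fixes I :: "('x free_word \<Rightarrow>\<^sub>0 'k::comm_ring_1) set" and X :: "'x set"
  defines "F \<equiv> free_algebra X :: ('k, _) module"
  assumes I: "ideal I F" and x: "x \<in> carrier F"
  shows "c \<odot>\<^bsub>quotient_algebra F I\<^esub> (I +>\<^bsub>F\<^esub> x) = I +>\<^bsub>F\<^esub> (c *\<^sub>K x)"
proof -
  interpret I: ideal I F by (rule I)
  have cx: "c *\<^sub>K x \<in> carrier F"
    using x unfolding F_def by (rule free_algebra_scale_closed)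
  have "I +>\<^bsub>F\<^esub> (c \<odot>\<^bsub>F\<^esub> y) = I +>\<^bsub>F\<^esub> (c *\<^sub>K x)" if "y \<in> I +>\<^bsub>F\<^esub> x" for y
  proof -
    from that obtain h where h: "h \<in> I" "y = h \<oplus>\<^bsub>F\<^esub> x"
      by (auto simp: a_r_coset_def r_coset_def)
    have c: "Poly_Mapping.single 0 c \<in> carrier F"
      unfolding F_def by (rule free_algebra_single_closed) (simp add: zero_free_word_def)
    have "Poly_Mapping.single 0 c \<otimes>\<^bsub>F\<^esub> h \<in> I"
      using h(1) c by (rule I.I_l_closed)
    then have "c *\<^sub>K h \<in> I"
      unfolding F_def by (simp add: free_algebra_def scale_conv_mult)
    moreover have "c \<odot>\<^bsub>F\<^esub> y = c *\<^sub>K h \<oplus>\<^bsub>F\<^esub> c *\<^sub>K x"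
      unfolding h(2) by (simp add: F_def free_algebra_def scale_conv_mult distrib_left)
    ultimately have "c \<odot>\<^bsub>F\<^esub> y \<in> I +>\<^bsub>F\<^esub> (c *\<^sub>K x)"
      by (auto simp: a_r_coset_def r_coset_def)
    then show ?thesis
      using I.a_repr_independence cx I.is_additive_subgroup I.a_rcos_self by (metis I.a_repr_independence')
  qed
  moreover have "I +>\<^bsub>F\<^esub> x \<noteq> {}"
    using I.a_rcos_self[OF x] by auto
  ultimately show ?thesis
    unfolding smult_quotient_algebra by auto
qed

lemma vectorspace_quotient_free_algebra:
  fixes I :: "('x free_word \<Rightarrow>\<^sub>0 'k::field) set" and X :: "'x set"
  defines "F \<equiv> free_algebra X :: ('k, _) module"
  assumes I: "ideal I F"
  shows "vectorspace (class_ring :: 'k ring) (quotient_algebra F I)"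
proof -
  interpret I: ideal I F by (rule I)
  interpret Q: ring "quotient_algebra F I"
    using I by (rule ring_quotient_algebra)
  have car: "\<exists>x\<in>carrier F. Y = I +>\<^bsub>F\<^esub> x" if "Y \<in> carrier (quotient_algebra F I)" for Y
    using that by (auto simp: carrier_quotient_algebra FactRing_def A_RCOSETS_def' a_r_coset_def r_coset_def)
  have in_car: "I +>\<^bsub>F\<^esub> x \<in> carrier (quotient_algebra F I)" if "x \<in> carrier F" for x
    using that by (auto simp: carrier_quotient_algebra FactRing_def A_RCOSETS_def' a_r_coset_def r_coset_def)
  have sc: "c *\<^sub>K x \<in> carrier F" if "x \<in> carrier F" for c x
    using that unfolding F_def by (rule free_algebra_scale_closed)
  have add: "(I +>\<^bsub>F\<^esub> x) \<oplus>\<^bsub>quotient_algebra F I\<^esub> (I +>\<^bsub>F\<^esub> y) = I +>\<^bsub>F\<^esub> (x + y)"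
    if "x \<in> carrier F" "y \<in> carrier F" for x y
    using I.a_rcos_sum[OF that] unfolding add_quotient_algebra
    by (simp add: FactRing_def) (simp add: F_def free_algebra_def)
  have smult: "c \<odot>\<^bsub>quotient_algebra F I\<^esub> (I +>\<^bsub>F\<^esub> x) = I +>\<^bsub>F\<^esub> (c *\<^sub>K x)" if "x \<in> carrier F" for c x
    using smult_coset_free_algebra[of I X x c] I that unfolding F_def by blast
  have plus: "x + y \<in> carrier F" if "x \<in> carrier F" "y \<in> carrier F" for x y
    using that unfolding F_def by (rule free_algebra_add_closed)
  have "module (class_ring :: 'k ring) (quotient_algebra F I)"
  proof (rule moduleI)
    show "cring (class_ring :: 'k ring)"
      using class_field[where 'a = 'k] by (simp add: field_def domain_def)
    show "abelian_group (quotient_algebra F I)" ..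
  qed (auto dest!: car
        simp: smult add sc plus in_car scale_add_left scale_add_right scale_scale scale_one)
  then show ?thesis
    using class_field[where 'a = 'k] by (simp add: vectorspace_def)
qed

lemma gen_closed:
  assumes "a \<in> index_set k l" "b \<in> index_set r s"
  shows "gen a b \<in> carrier (free_algebra (index_set k l \<times> index_set r s))"
  unfolding gen_def using assms by (intro free_algebra_single_closed) auto

lemma relations_closed:
  "relations k l r s \<subseteq> carrier (free_algebra (index_set k l \<times> index_set r s))"
  unfolding relations_def Let_def power2_eq_square
  by (auto intro!: free_algebra_diff_closed free_algebra_add_closed free_algebra_scale_closed
        free_algebra_mult_closed gen_closed)

lemma ideal_relations:
  "ideal (Idl\<^bsub>free_algebra (index_set k l \<times> index_set r s) :: (ratfun, _) module\<^esub> relations k l r s)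
    (free_algebra (index_set k l \<times> index_set r s) :: (ratfun, _) module)"
  using ring_free_algebra relations_closed by (rule ring.genideal_ideal)

lemma ring_M_alg: "ring (M_alg k l r s)"
  unfolding M_alg_def presented_algebra_def by (intro ring_quotient_algebra ideal_relations)

lemma vectorspace_M_alg: "vectorspace class_ring (M_alg k l r s)"
  unfolding M_alg_def presented_algebra_def by (intro vectorspace_quotient_free_algebra ideal_relations)

end

theory Submission
  imports Defs
begin

text \<open>
  Write letters \<open>(a, c)\<close> for the generators \<open>t\<^sub>a\<^sub>c\<close>. A word in them is sorted if it is one of the
  ordered monomials: columns weakly increase, rows weakly increase within a column, and odd letters
  are not repeated. The claim is that the sorted words are a basis of the free algebra modulo the
  ideal \<open>I\<close> of the relations.

  \<^bold>\<open>Spanning.\<close> Each relation expresses an adjacent pair of letters that is out of order by pairs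
  whose first letter is smaller (\<open>reduce_pair\<close>). Words of a fixed length get lexicographically
  smaller in this way, so that every word is congruent to a combination of sorted words
  (\<open>sorted_words_span\<close>).

  \<^bold>\<open>Independence.\<close> For each sorted word there is a linear functional on the free algebra that
  vanishes on \<open>I\<close>, takes the value 1 at that word and 0 at all other sorted words. The functional
  computes a coefficient of a normal form in two stages.

  First, the letters of a word are inserted one by one, from the last to the first, into a word
  whose columns are sorted. A letter \<open>x = (a, c)\<close> moves to the right past \<open>y = (b, d)\<close> with
  \<open>d < c\<close> by the consequence
  \<open>xy = \<alpha> yx + \<beta> (a, d)(b, c)\<close>
  of the relations; the columns are exchanged and the rows are acted upon by the R-matrix of the
  vector representation of the quantum general linear supergroup. Second, the column-sorted word
  is read in a product of quantum affine superspaces, one for each column, where reordering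
  multiplies it by a scalar.

  That the result respects all relations rests on one identity in three letters, the Yang-Baxter
  equation (\<open>braid\<close>). It implies that inserting \<open>x\<close> and \<open>y\<close> from different columns agrees with
  inserting the right-hand side of their exchange rule (\<open>insert_pair_descent\<close>). Letters of the same
  column \<open>c\<close> are treated by the observation that the relations within the column say precisely that
  the exchange operator acts by its eigenvalue \<open>q\<^sub>c\<close>. By the Yang-Baxter equation again, a functional
  with this property keeps it when a letter is inserted in front
  (\<open>column_symmetric_insert_letter\<close>) and when a pair of letters of equal column is inserted
  (\<open>insert_pair_same_column\<close>). Since \<open>q\<^sup>2 \<noteq> -1\<close>, the eigenvalue condition forces the squares of the
  odd generators to vanish.
\<close>

section \<open>Linear functionals and bases of quotients of free algebras\<close>

lemma sum_single_keys: "(\<Sum>w\<in>Poly_Mapping.keys p. Poly_Mapping.single w (Poly_Mapping.lookup p w)) = p"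
  by (rule poly_mapping_eqI)
    (auto simp: lookup_sum lookup_single when_def in_keys_iff)

definition pairing :: "('x free_word \<Rightarrow> 'k) \<Rightarrow> ('x free_word \<Rightarrow>\<^sub>0 'k::comm_ring_1) \<Rightarrow> 'k" where
  "pairing g p = (\<Sum>w\<in>Poly_Mapping.keys p. Poly_Mapping.lookup p w * g w)"

lemma pairing_superset:
  assumes "finite A" "Poly_Mapping.keys p \<subseteq> A"
  shows "pairing g p = (\<Sum>w\<in>A. Poly_Mapping.lookup p w * g w)"
  unfolding pairing_def using assms by (intro sum.mono_neutral_left) (auto simp: in_keys_iff)

lemma pairing_zero [simp]: "pairing g 0 = 0"
  by (simp add: pairing_def)

lemma pairing_add: "pairing g (p + p') = pairing g p + pairing g p'"
proof -
  let ?A = "Poly_Mapping.keys p \<union> Poly_Mapping.keys p'"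
  have "pairing g (p + p') = (\<Sum>w\<in>?A. Poly_Mapping.lookup (p + p') w * g w)"
    by (intro pairing_superset) (simp_all add: Poly_Mapping.keys_add)
  also have "\<dots> = (\<Sum>w\<in>?A. Poly_Mapping.lookup p w * g w) + (\<Sum>w\<in>?A. Poly_Mapping.lookup p' w * g w)"
    by (simp add: lookup_add distrib_right sum.distrib)
  finally show ?thesis
    by (simp add: pairing_superset[of ?A p] pairing_superset[of ?A p'])
qed

lemma pairing_single: "pairing g (Poly_Mapping.single w c) = c * g w"
  by (simp add: pairing_def)

lemma pairing_uminus: "pairing g (- p) = - pairing g p"
  using pairing_add[of g p "- p"] by (simp add: add_eq_0_iff)

lemma pairing_diff: "pairing g (p - p') = pairing g p - pairing g p'"
  using pairing_add[of g p "- p'"] by (simp add: pairing_uminus)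

lemma pairing_sum: "pairing g (\<Sum>i\<in>A. p i) = (\<Sum>i\<in>A. pairing g (p i))"
  by (induction A rule: infinite_finite_induct) (simp_all add: pairing_add)

lemma pairing_scale: "pairing g (c *\<^sub>K p) = c * pairing g p"
proof -
  have "c *\<^sub>K p = (\<Sum>w\<in>Poly_Mapping.keys p. Poly_Mapping.single w (c * Poly_Mapping.lookup p w))"
    using arg_cong[OF sum_single_keys[of p], of "\<lambda>p. c *\<^sub>K p"]
    by (simp add: scale_conv_mult sum_distrib_left mult_single)
  then have "pairing g (c *\<^sub>K p) = (\<Sum>w\<in>Poly_Mapping.keys p. c * Poly_Mapping.lookup p w * g w)"
    by (simp only: pairing_sum pairing_single)
  then show ?thesis
    by (simp add: pairing_def sum_distrib_left mult.assoc)
qed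

lemma scalar_central: "p * Poly_Mapping.single 0 d = Poly_Mapping.single 0 d * p"
  for p :: "'x free_word \<Rightarrow>\<^sub>0 'k::comm_ring_1"
proof -
  let ?s = "\<Sum>w\<in>Poly_Mapping.keys p. Poly_Mapping.single w (Poly_Mapping.lookup p w)"
  have "?s * Poly_Mapping.single 0 d = Poly_Mapping.single 0 d * ?s"
    by (simp add: sum_distrib_left sum_distrib_right mult_single mult.commute)
  then show ?thesis by (simp only: sum_single_keys)
qed

lemma pairing_mult_words:
  fixes p x y :: "'x free_word \<Rightarrow>\<^sub>0 'k::comm_ring_1"
  assumes "\<And>u v. pairing g (Poly_Mapping.single u 1 * p * Poly_Mapping.single v 1) = 0"
  shows "pairing g (x * p * y) = 0"
proof -
  have "pairing g (Poly_Mapping.single w c * p * Poly_Mapping.single w' d) = 0" for w w' c d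
  proof -
    have "Poly_Mapping.single w c * p * Poly_Mapping.single w' d
      = Poly_Mapping.single 0 c * (Poly_Mapping.single w 1 * p * Poly_Mapping.single w' 1 * Poly_Mapping.single 0 d)"
      by (simp add: mult_single mult.assoc flip: mult.assoc[of "Poly_Mapping.single 0 c"])
    also have "\<dots> = c *\<^sub>K (d *\<^sub>K (Poly_Mapping.single w 1 * p * Poly_Mapping.single w' 1))"
      by (simp only: scalar_central scale_conv_mult)
    finally show ?thesis
      by (simp only: pairing_scale assms mult_zero_right)
  qed
  then have "pairing g ((\<Sum>w\<in>Poly_Mapping.keys x. Poly_Mapping.single w (Poly_Mapping.lookup x w)) * p
    * (\<Sum>w\<in>Poly_Mapping.keys y. Poly_Mapping.single w (Poly_Mapping.lookup y w))) = 0"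
    by (simp add: sum_distrib_left sum_distrib_right pairing_sum)
  then show ?thesis by (simp only: sum_single_keys)
qed

text \<open>A functional that kills all \<open>u p v\<close>, where \<open>p\<close> is a relation and \<open>u\<close>, \<open>v\<close> are words, kills the
  ideal: the elements that it annihilates together with all their two-sided multiples form an ideal
  containing the relations.\<close>

lemma pairing_genideal:
  fixes S :: "('x free_word \<Rightarrow>\<^sub>0 'k::comm_ring_1) set"
  assumes S: "S \<subseteq> carrier (free_algebra X)"
    and ann: "\<And>p u v. p \<in> S \<Longrightarrow> pairing g (Poly_Mapping.single u 1 * p * Poly_Mapping.single v 1) = 0"
    and p: "p \<in> Idl\<^bsub>free_algebra X :: ('k, _) module\<^esub> S"
  shows "pairing g p = 0"
proof -
  let ?F = "free_algebra X :: ('k, _) module"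
  \<comment> \<open>Quantifying over arbitrary multiples makes the closure properties of an ideal immediate.\<close>
  let ?J = "{p \<in> carrier ?F. \<forall>x y. pairing g (x * p * y) = 0}"
  interpret F: ring ?F by (rule ring_free_algebra)
  have "ideal ?J ?F"
  proof (rule idealI[OF ring_free_algebra])
    show "subgroup ?J (add_monoid ?F)"
    proof (rule group.subgroupI[OF F.a_group])
      fix a assume a: "a \<in> ?J"
      then have "\<ominus>\<^bsub>?F\<^esub> a = - a"
        by (intro F.minus_equality) (auto simp: free_algebra_def)
      moreover have "- a \<in> ?J"
        using a free_algebra_uminus_closed[of a X] by (simp add: pairing_uminus)
      ultimately show "inv\<^bsub>add_monoid ?F\<^esub> a \<in> ?J"
        by (simp only: a_inv_def)
    next
      fix a b assume ab: "a \<in> ?J" "b \<in> ?J"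
      then have "a + b \<in> ?J"
        using free_algebra_add_closed[of a X b] by (simp add: distrib_left distrib_right pairing_add)
      then show "a \<otimes>\<^bsub>add_monoid ?F\<^esub> b \<in> ?J"
        by (simp add: free_algebra_def)
    next
      have "0 \<in> ?J" by (simp add: free_algebra_def)
      then show "?J \<noteq> {}" by blast
    qed (simp add: Collect_restrict)
  next
    fix a x assume a: "a \<in> ?J" and x: "x \<in> carrier ?F"
    have "pairing g (y * (x * a) * z) = 0" "pairing g (y * (a * x) * z) = 0" for y z
    proof -
      have "pairing g ((y * x) * a * z) = 0" "pairing g (y * a * (x * z)) = 0"
        using a by blast+
      then show "pairing g (y * (x * a) * z) = 0" "pairing g (y * (a * x) * z) = 0"
        by (simp_all only: mult.assoc)
    qed
    then have "x * a \<in> ?J" "a * x \<in> ?J"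
      using free_algebra_mult_closed[of a X x] free_algebra_mult_closed[of x X a] a x by simp_all
    then show "x \<otimes>\<^bsub>?F\<^esub> a \<in> ?J" "a \<otimes>\<^bsub>?F\<^esub> x \<in> ?J"
      by (simp_all add: free_algebra_def)
  qed
  moreover have "S \<subseteq> ?J"
    using S ann pairing_mult_words by blast
  ultimately have "p \<in> ?J"
    using F.genideal_minimal p by blast
  then have "pairing g (1 * p * 1) = 0" by blast
  then show ?thesis by simp
qed

context
  fixes X :: "'x set" and I :: "('x free_word \<Rightarrow>\<^sub>0 'k::field) set"
    and F :: "('k, 'x free_word \<Rightarrow>\<^sub>0 'k) module"
  defines "F \<equiv> free_algebra X"
  assumes ideal_I: "ideal I F"
begin

interpretation I: ideal I F by (rule ideal_I)

lemma coset_eq_iff: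
  assumes "p \<in> carrier F" "p' \<in> carrier F"
  shows "I +>\<^bsub>F\<^esub> p = I +>\<^bsub>F\<^esub> p' \<longleftrightarrow> p - p' \<in> I"
proof -
  have "- p' \<in> carrier F"
    using assms(2) unfolding F_def by (rule free_algebra_uminus_closed)
  then have "\<ominus>\<^bsub>F\<^esub> p' = - p'"
    using assms(2) by (intro I.minus_equality) (auto simp: F_def free_algebra_def)
  then have "p \<ominus>\<^bsub>F\<^esub> p' = p - p'"
    by (simp add: a_minus_def) (simp add: F_def free_algebra_def)
  then show ?thesis
    using I.quotient_eq_iff_same_a_r_cos[OF ideal_I assms] by simp
qed

lemma coset_add:
  assumes "p \<in> carrier F" "p' \<in> carrier F"
  shows "(I +>\<^bsub>F\<^esub> p) \<oplus>\<^bsub>quotient_algebra F I\<^esub> (I +>\<^bsub>F\<^esub> p') = I +>\<^bsub>F\<^esub> (p + p')"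
  using I.a_rcos_sum[OF assms] unfolding add_quotient_algebra
  by (simp add: FactRing_def) (simp add: F_def free_algebra_def)

lemma coset_mult:
  assumes "p \<in> carrier F" "p' \<in> carrier F"
  shows "(I +>\<^bsub>F\<^esub> p) \<otimes>\<^bsub>quotient_algebra F I\<^esub> (I +>\<^bsub>F\<^esub> p') = I +>\<^bsub>F\<^esub> (p * p')"
  using I.rcoset_mult_add[OF assms] unfolding mult_quotient_algebra
  by (simp add: FactRing_def) (simp add: F_def free_algebra_def)

lemma coset_one: "\<one>\<^bsub>quotient_algebra F I\<^esub> = I +>\<^bsub>F\<^esub> 1"
  unfolding one_quotient_algebra by (simp add: FactRing_def) (simp add: F_def free_algebra_def)

lemma coset_zero: "\<zero>\<^bsub>quotient_algebra F I\<^esub> = I +>\<^bsub>F\<^esub> 0"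
proof -
  have "I +>\<^bsub>F\<^esub> \<zero>\<^bsub>F\<^esub> = I"
    using I.a_coset_add_zero I.a_subset by blast
  then show ?thesis
    unfolding zero_quotient_algebra by (simp add: FactRing_def) (simp add: F_def free_algebra_def)
qed

lemma coset_carrier: "p \<in> carrier F \<Longrightarrow> I +>\<^bsub>F\<^esub> p \<in> carrier (quotient_algebra F I)"
  by (auto simp: carrier_quotient_algebra FactRing_def A_RCOSETS_def' a_r_coset_def r_coset_def)

lemma carrier_cosetE:
  assumes "Y \<in> carrier (quotient_algebra F I)"
  obtains p where "p \<in> carrier F" "Y = I +>\<^bsub>F\<^esub> p"
  using assms by (auto simp: carrier_quotient_algebra FactRing_def A_RCOSETS_def' a_r_coset_def r_coset_def)

lemma coset_smult_word:
  assumes "set (letters w) \<subseteq> X"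
  shows "c \<odot>\<^bsub>quotient_algebra F I\<^esub> (I +>\<^bsub>F\<^esub> Poly_Mapping.single w 1) = I +>\<^bsub>F\<^esub> Poly_Mapping.single w c"
  using smult_coset_free_algebra[of I X "Poly_Mapping.single w 1" c] ideal_I
    free_algebra_single_closed[OF assms, of 1]
  by (simp add: F_def scale_conv_mult mult_single)

text \<open>Linear combinations of cosets of words are computed on representatives; this translates linear
  dependence in the quotient into membership in \<open>I\<close>.\<close>

lemma coset_words_sum:
  assumes "finite A" "\<And>w. w \<in> A \<Longrightarrow> set (letters w) \<subseteq> X"
  shows "(\<Oplus>\<^bsub>quotient_algebra F I\<^esub>w\<in>A. b w \<odot>\<^bsub>quotient_algebra F I\<^esub> (I +>\<^bsub>F\<^esub> Poly_Mapping.single w 1))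
    = I +>\<^bsub>F\<^esub> (\<Sum>w\<in>A. Poly_Mapping.single w (b w))"
    (is "?L A = _")
proof -
  interpret Q: ring "quotient_algebra F I" by (rule ring_quotient_algebra[OF ideal_I])
  have single: "Poly_Mapping.single w c \<in> carrier F" if "w \<in> A" for w c
    unfolding F_def by (rule free_algebra_single_closed) (rule assms(2)[OF that])
  have "?L B = I +>\<^bsub>F\<^esub> (\<Sum>w\<in>B. Poly_Mapping.single w (b w)) \<and> (\<Sum>w\<in>B. Poly_Mapping.single w (b w)) \<in> carrier F"
    if "finite B" "B \<subseteq> A" for B
    using that
  proof (induction B)
    case empty
    show ?case by (simp add: coset_zero) (simp add: F_def free_algebra_def)
  next
    case (insert w B)
    have sm: "b v \<odot>\<^bsub>quotient_algebra F I\<^esub> (I +>\<^bsub>F\<^esub> Poly_Mapping.single v 1)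
        = I +>\<^bsub>F\<^esub> Poly_Mapping.single v (b v)" if "v \<in> A" for v
      by (rule coset_smult_word) (rule assms(2)[OF that])
    have "?L (insert w B) = b w \<odot>\<^bsub>quotient_algebra F I\<^esub> (I +>\<^bsub>F\<^esub> Poly_Mapping.single w 1)
        \<oplus>\<^bsub>quotient_algebra F I\<^esub> ?L B"
      using insert by (intro Q.finsum_insert) (auto simp: sm intro!: coset_carrier single)
    also have "\<dots> = I +>\<^bsub>F\<^esub> (Poly_Mapping.single w (b w) + (\<Sum>w\<in>B. Poly_Mapping.single w (b w)))"
      using insert by (subst sm) (auto intro!: coset_add single)
    finally show ?case
      using insert single free_algebra_add_closed unfolding F_def by (simp add: free_algebra_add_closed)
  qed
  then show ?thesis using assms(1) by blast
qed

lemma coset_words_prod: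
  assumes "\<And>w. w \<in> set ws \<Longrightarrow> set w \<subseteq> X"
  shows "foldr (\<otimes>\<^bsub>quotient_algebra F I\<^esub>) (map (\<lambda>w. I +>\<^bsub>F\<^esub> Poly_Mapping.single (Word w) 1) ws) \<one>\<^bsub>quotient_algebra F I\<^esub>
    = I +>\<^bsub>F\<^esub> Poly_Mapping.single (Word (concat ws)) 1"
  using assms
proof (induction ws)
  case Nil
  show ?case by (simp add: coset_one zero_free_word_def flip: single_one)
next
  case (Cons w ws)
  have "Poly_Mapping.single (Word w) 1 \<in> carrier F" "Poly_Mapping.single (Word (concat ws)) 1 \<in> carrier F"
    using Cons.prems unfolding F_def by (intro free_algebra_single_closed; fastforce)+
  then show ?case
    using Cons by (simp add: coset_mult mult_single plus_free_word_def)
qed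

lemma coset_word_power:
  assumes "set w \<subseteq> X"
  shows "(I +>\<^bsub>F\<^esub> Poly_Mapping.single (Word w) 1) [^]\<^bsub>quotient_algebra F I\<^esub> (n :: nat)
    = I +>\<^bsub>F\<^esub> Poly_Mapping.single (Word (concat (replicate n w))) 1"
proof (induction n)
  case 0
  show ?case by (simp add: coset_one zero_free_word_def flip: single_one)
next
  case (Suc n)
  have "Poly_Mapping.single (Word w) 1 \<in> carrier F"
    "Poly_Mapping.single (Word (concat (replicate n w))) 1 \<in> carrier F"
    using assms unfolding F_def by (intro free_algebra_single_closed; fastforce)+
  moreover have "concat (replicate n w) @ w = w @ concat (replicate n w)"
    by (induction n) simp_all
  ultimately show ?case
    using Suc by (simp add: coset_mult mult_single plus_free_word_def)
qed

lemma ideal_add: "p \<in> I \<Longrightarrow> p' \<in> I \<Longrightarrow> p + p' \<in> I"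
  using additive_subgroup.a_closed[OF I.additive_subgroup_axioms, of p p']
  by (simp add: F_def free_algebra_def)

lemma ideal_zero: "0 \<in> I"
  using additive_subgroup.zero_closed[OF I.additive_subgroup_axioms]
  by (simp add: F_def free_algebra_def)

lemma ideal_sum: "(\<And>i. i \<in> A \<Longrightarrow> h i \<in> I) \<Longrightarrow> sum h A \<in> I"
  by (induction A rule: infinite_finite_induct) (simp_all add: ideal_add ideal_zero)

lemma ideal_mult:
  assumes "p \<in> I" "x \<in> carrier F"
  shows "x * p \<in> I" "p * x \<in> I"
  using I.I_l_closed[OF assms] I.I_r_closed[OF assms] by (simp_all add: F_def free_algebra_def)

lemma ideal_scale: "p \<in> I \<Longrightarrow> c *\<^sub>K p \<in> I"
  unfolding scale_conv_mult F_def
  by (rule ideal_mult) (simp_all add: F_def free_algebra_single_closed zero_free_word_def)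

text \<open>This carries normal forms of words, which are found by induction on words, over to normal forms of
  arbitrary elements. The induction itself uses it for the combination of words that results from
  a rewriting step.\<close>

lemma normal_form_linear:
  assumes "\<And>w. w \<in> Poly_Mapping.keys p \<Longrightarrow>
    \<exists>n. Poly_Mapping.keys n \<subseteq> W \<and> Poly_Mapping.single w 1 - n \<in> I"
  shows "\<exists>n. Poly_Mapping.keys n \<subseteq> W \<and> p - n \<in> I"
proof -
  obtain n where n: "\<And>w. w \<in> Poly_Mapping.keys p \<Longrightarrow> Poly_Mapping.keys (n w) \<subseteq> W"
    "\<And>w. w \<in> Poly_Mapping.keys p \<Longrightarrow> Poly_Mapping.single w 1 - n w \<in> I"
    using assms by metis
  define m where "m = (\<Sum>w\<in>Poly_Mapping.keys p. Poly_Mapping.lookup p w *\<^sub>K n w)"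
  have "Poly_Mapping.keys (c *\<^sub>K n w) \<subseteq> W" if "w \<in> Poly_Mapping.keys p" for w c
    using n(1)[OF that] Poly_Mapping.keys_mult[of "Poly_Mapping.single 0 c" "n w"]
    by (auto simp: scale_conv_mult split: if_splits)
  then have "Poly_Mapping.keys m \<subseteq> W"
    unfolding m_def using Poly_Mapping.keys_sum by fastforce
  moreover have "p - m = (\<Sum>w\<in>Poly_Mapping.keys p.
      Poly_Mapping.lookup p w *\<^sub>K (Poly_Mapping.single w 1 - n w))"
    using sum_single_keys[of p]
    by (simp add: m_def scale_conv_mult right_diff_distrib mult_single sum_subtractf)
  then have "p - m \<in> I"
    by (simp add: ideal_sum ideal_scale n(2))
  ultimately show ?thesis by blast
qed

text \<open>A set of words is a basis modulo \<open>I\<close> as soon as it spans and each member is singled out by a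
  functional on the quotient: applied to a vanishing linear combination, these functionals return
  its coefficients one at a time.\<close>

theorem quotient_free_algebra_basis:
  assumes W: "\<And>w. w \<in> W \<Longrightarrow> set (letters w) \<subseteq> X"
    and spanning: "\<And>w. set (letters w) \<subseteq> X \<Longrightarrow>
      \<exists>n. Poly_Mapping.keys n \<subseteq> W \<and> Poly_Mapping.single w 1 - n \<in> I"
    and separating: "\<And>w. w \<in> W \<Longrightarrow>
      \<exists>g. (\<forall>p\<in>I. pairing g p = 0) \<and> (\<forall>w'\<in>W. g w' = (if w' = w then 1 else 0))"
  shows "inj_on (\<lambda>w. I +>\<^bsub>F\<^esub> Poly_Mapping.single w 1) W"
    and "vectorspace.basis class_ring (quotient_algebra F I)
      ((\<lambda>w. I +>\<^bsub>F\<^esub> Poly_Mapping.single w 1) ` W)"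
proof -
  let ?Q = "quotient_algebra F I"
  let ?c = "\<lambda>w. I +>\<^bsub>F\<^esub> Poly_Mapping.single w 1"
  interpret V: vectorspace "class_ring :: 'k ring" ?Q
    using vectorspace_quotient_free_algebra ideal_I unfolding F_def .
  have single: "Poly_Mapping.single w c \<in> carrier F" if "set (letters w) \<subseteq> X" for w c
    unfolding F_def using that by (rule free_algebra_single_closed)
  have sum_carrier: "p \<in> carrier F" if "Poly_Mapping.keys p \<subseteq> W" for p
    using that W unfolding F_def free_algebra_def by auto
  show inj: "inj_on ?c W"
  proof (rule inj_onI)
    fix w w' assume w: "w \<in> W" "w' \<in> W" and eq: "?c w = ?c w'"
    have "Poly_Mapping.single w 1 - Poly_Mapping.single w' 1 \<in> I"
      using eq coset_eq_iff[OF single[OF W[OF w(1)]] single[OF W[OF w(2)]]] by simp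
    moreover obtain g where "\<forall>p\<in>I. pairing g p = 0" "\<forall>w'\<in>W. g w' = (if w' = w then 1 else 0)"
      using separating[OF w(1)] by blast
    ultimately have "g w - g w' = 0"
      by (metis mult_1 pairing_diff pairing_single)
    then show "w = w'"
      using \<open>\<forall>w'\<in>W. g w' = (if w' = w then 1 else 0)\<close> w by (auto split: if_splits)
  qed
  have cW: "?c ` W \<subseteq> carrier ?Q"
    using W single coset_carrier by blast
  have lincomb: "V.lincomb a (?c ` A) = I +>\<^bsub>F\<^esub> (\<Sum>w\<in>A. Poly_Mapping.single w (a (?c w)))"
    if "finite A" "A \<subseteq> W" for A a
  proof -
    have "V.lincomb a (?c ` A) = (\<Oplus>\<^bsub>?Q\<^esub>w\<in>A. a (?c w) \<odot>\<^bsub>?Q\<^esub> ?c w)"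
      unfolding V.lincomb_def
      using that inj cW by (intro V.finsum_reindex) (auto intro: inj_on_subset intro!: V.smult_closed)
    also have "\<dots> = I +>\<^bsub>F\<^esub> (\<Sum>w\<in>A. Poly_Mapping.single w (a (?c w)))"
      using that W by (intro coset_words_sum) auto
    finally show ?thesis .
  qed
  have "\<not> V.lin_dep (?c ` W)"
  proof
    assume "V.lin_dep (?c ` W)"
    then obtain A' a v where A': "finite A'" "A' \<subseteq> ?c ` W" "V.lincomb a A' = \<zero>\<^bsub>?Q\<^esub>" "v \<in> A'" "a v \<noteq> 0"
      unfolding V.lin_dep_def by auto
    then obtain A where A: "A \<subseteq> W" "finite A" "A' = ?c ` A"
      by (metis finite_subset_image)
    then obtain w where w: "w \<in> A" "v = ?c w" using A'(4) by blast
    let ?p = "\<Sum>w\<in>A. Poly_Mapping.single w (a (?c w))"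
    have "Poly_Mapping.keys ?p \<subseteq> W"
      using Poly_Mapping.keys_sum[of "\<lambda>w. Poly_Mapping.single w (a (?c w))" A] A(1) by (auto split: if_splits)
    then have "?p - 0 \<in> I"
      using A'(3) lincomb[OF A(2,1)] A(3)
      by (subst coset_eq_iff[symmetric]) (auto simp: coset_zero intro!: sum_carrier)
    moreover obtain g where g: "\<forall>p\<in>I. pairing g p = 0" "\<forall>w'\<in>W. g w' = (if w' = w then 1 else 0)"
      using separating w A(1) by blast
    ultimately have "(\<Sum>w'\<in>A. a (?c w') * g w') = 0"
      by (simp flip: pairing_single pairing_sum)
    also have "(\<Sum>w'\<in>A. a (?c w') * g w') = (\<Sum>w'\<in>A. if w' = w then a (?c w) else 0)"
      using g(2) A(1) by (intro sum.cong) auto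
    finally show False
      using w A(2) A'(5) by simp
  qed
  moreover have "V.span (?c ` W) = carrier ?Q"
  proof
    show "V.span (?c ` W) \<subseteq> carrier ?Q"
      using cW by (rule V.span_is_subset2)
    show "carrier ?Q \<subseteq> V.span (?c ` W)"
    proof
      fix Y assume "Y \<in> carrier ?Q"
      then obtain p where p: "p \<in> carrier F" "Y = I +>\<^bsub>F\<^esub> p"
        by (rule carrier_cosetE)
      obtain m where m: "Poly_Mapping.keys m \<subseteq> W" "p - m \<in> I"
        using normal_form_linear[of p W] spanning p(1) by (auto simp: F_def free_algebra_def)
      then have "Y = I +>\<^bsub>F\<^esub> m"
        using p sum_carrier by (simp add: coset_eq_iff)
      \<comment> \<open>Coefficients of a linear combination are indexed by cosets, hence the detour through the
        inverse of the coset map on \<open>W\<close>.\<close>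
      also have "m = (\<Sum>w\<in>Poly_Mapping.keys m. Poly_Mapping.single w (Poly_Mapping.lookup m (inv_into W ?c (?c w))))"
      proof -
        have "Poly_Mapping.lookup m (inv_into W ?c (?c w)) = Poly_Mapping.lookup m w"
          if "w \<in> Poly_Mapping.keys m" for w
          using that m(1) inj by (subst inv_into_f_f) auto
        then show ?thesis using sum_single_keys[of m] by simp
      qed
      also have "I +>\<^bsub>F\<^esub> \<dots> = V.lincomb (\<lambda>Y. Poly_Mapping.lookup m (inv_into W ?c Y)) (?c ` Poly_Mapping.keys m)"
        using m(1) by (intro lincomb[symmetric]) auto
      finally show "Y \<in> V.span (?c ` W)"
        unfolding V.span_def using m(1) by force
    qed
  qed
  ultimately show "V.basis (?c ` W)"
    unfolding V.basis_def using cW by blast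
qed

end

section \<open>The exchange rule and the Yang-Baxter equation\<close>

type_synonym letter = "nat \<times> nat"

lemma q_nonzero: "q \<noteq> 0"
  by (simp add: q_def Zero_fract_def eq_fract)

text \<open>The exchange operator on pairs of letters of column \<open>c\<close> has the eigenvalues \<open>q\<^sub>c\<close> and \<open>- q\<^sub>c\<^sup>-\<^sup>1\<close>. They
  are distinct, which is why the squares of the odd generators have to vanish.\<close>

lemma q_square_ne_minus_one: "q * q \<noteq> - 1"
proof
  assume "q * q = - 1"
  then have "Fract [:0, 0, 1:] 1 = Fract [:- 1 :: complex:] 1"
    by (simp add: q_def One_fract_def one_pCons)
  then show False by (simp add: eq_fract)
qed

lemma q_index_alt: "q_index m a = (if a \<le> m then q else inverse q)"
  by (simp add: q_index_def parity_def)

lemma parity_cases: "parity m a = 0 \<or> parity m a = 1"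
  by (simp add: parity_def)

context
  fixes k r :: nat
begin

definition deg :: "letter \<Rightarrow> nat" where
  "deg x = parity k (fst x) + parity r (snd x)"

definition swap_coeff :: "letter \<Rightarrow> letter \<Rightarrow> ratfun" where
  "swap_coeff x y = (- 1) ^ (deg x * deg y) * (if fst x = fst y then q_index k (fst x) else 1)"

text \<open>For \<open>x = (a, c)\<close>, \<open>y = (b, d)\<close> the sign combines the one in the last defining relation, for \<open>t\<^sub>b\<^sub>c t\<^sub>a\<^sub>d\<close>, with the one that
  arises from commuting these two generators into the order \<open>t\<^sub>a\<^sub>d t\<^sub>b\<^sub>c\<close>.\<close>

definition hold_coeff :: "letter \<Rightarrow> letter \<Rightarrow> ratfun" where
  "hold_coeff x y = (if fst y < fst x
     then (- 1) ^ (parity k (fst x) * (parity r (snd x) + parity r (snd y))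
                   + parity r (snd x) * parity r (snd y)) * (q - inverse q)
     else 0)"

text \<open>The exchange rule \<open>(a, c)(b, d) \<mapsto> \<alpha> (b, d)(a, c) + \<beta> (a, d)(b, c)\<close>, composed with a function \<open>f\<close>
  of the two resulting letters. Passing \<open>f\<close> as a continuation represents linear maps between
  spaces of words by their transposes, acting on arbitrary functions of words. The formula makes
  sense for all columns \<open>c\<close>, \<open>d\<close>, and is used for \<open>d < c\<close> and for \<open>c = d\<close>.\<close>

definition cross :: "letter \<Rightarrow> letter \<Rightarrow> (letter \<Rightarrow> letter \<Rightarrow> ratfun) \<Rightarrow> ratfun" where
  "cross x y f = swap_coeff x y * f y x + hold_coeff x y * f (fst x, snd y) (fst y, snd x)"

text \<open>The Hecke relation for the diagonal entry of the R-matrix; it is what makes the Yang-Baxter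
  equation hold when two of the rows coincide.\<close>

lemma q_index_square: "q_index k a * q_index k a = 1 + (- 1) ^ parity k a * ((q - inverse q) * q_index k a)"
  using q_nonzero by (simp add: q_index_alt parity_def algebra_simps)

text \<open>The sign bicharacter. Written in terms of it, the coefficients are products of factors with square
  1, so that the Yang-Baxter equation needs no case distinction on parities.\<close>

definition sg :: "nat \<Rightarrow> nat \<Rightarrow> ratfun" where
  "sg m n = (- 1) ^ (m * n)"

lemma sg_commute: "sg m n = sg n m"
  by (simp add: sg_def mult.commute)

lemma sg_square: "sg m n * sg m n = 1" "sg m n * (sg m n * u) = u"
  by (simp_all add: sg_def flip: mult.assoc power_add)

lemma sg_add: "sg (m + m') n = sg m n * sg m' n" "sg m (n + n') = sg m n * sg m n'"
  by (simp_all add: sg_def power_add algebra_simps)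

lemma swap_coeff_sg: "swap_coeff (a, c) (b, d)
    = sg (parity k a) (parity k b) * (sg (parity k a) (parity r d) * (sg (parity k b) (parity r c)
       * (sg (parity r c) (parity r d) * (if a = b then q_index k a else 1))))"
  unfolding swap_coeff_def deg_def sg_def[symmetric] by (simp add: sg_add sg_commute mult_ac)

lemma hold_coeff_sg: "hold_coeff (a, c) (b, d) = (if b < a
    then sg (parity k a) (parity r c) * (sg (parity k a) (parity r d) * (sg (parity r c) (parity r d) * (q - inverse q)))
    else 0)"
  unfolding hold_coeff_def by (simp add: sg_def power_add distrib_left mult_ac)

lemma q_index_square_sg:
   "q_index k a * q_index k a = 1 + sg (parity k a) (parity k a) * ((q - inverse q) * q_index k a)"
  using q_index_square[of a] parity_cases[of k a] by (auto simp: sg_def)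

text \<open>Expanding both sides gives combinations of the values of \<open>f\<close> at the permutations of the three
  rows, the columns always being reversed. The coefficients depend on the relative order of the
  rows, which can be any of the 13 weak orders. In each of them the comparison uses only that signs
  square to 1 and, for coinciding rows, the Hecke relation.\<close>

lemma braid_coords:
  "cross (a, c) (b, d) (\<lambda>y' x'. cross x' (e, g) (\<lambda>z' x''. cross y' z' (\<lambda>z'' y''. f z'' y'' x'')))
   = cross (b, d) (e, g) (\<lambda>z' y'. cross (a, c) z' (\<lambda>z'' x'. cross x' y' (\<lambda>y'' x''. f z'' y'' x'')))"
proof -
  define h where "h = q - inverse q"
  define Q where "Q = q_index k"
  define p where "p = parity k"
  define p' where "p' = parity r"
  note S = swap_coeff_sg[folded Q_def p_def p'_def]
  note H = hold_coeff_sg[folded h_def p_def p'_def]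
  have hecke: "Q a * Q a = 1 + sg (p a) (p a) * (h * Q a)" for a
    using q_index_square_sg unfolding Q_def h_def p_def .
  have hecke': "Q a * (Q a * u) = u + sg (p a) (p a) * (h * (Q a * u))" for a u
    by (subst mult.assoc[symmetric], subst hecke) (simp add: algebra_simps)
  consider "a < b" "b < e" | "a < e" "e < b" | "b < a" "a < e" | "b < e" "e < a" | "e < a" "a < b"
    | "e < b" "b < a" | "a = b" "b < e" | "a = b" "e < b" | "a = e" "a < b" | "a = e" "b < a"
    | "b = e" "a < b" | "b = e" "b < a" | "a = b" "b = e"
    using less_linear[of a b] less_linear[of b e] less_linear[of a e] by fast
  then show ?thesis
    unfolding cross_def fst_conv snd_conv
    by cases (simp_all add: S H, simp_all add: algebra_simps sg_square hecke hecke' sg_commute)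
qed

text \<open>The Yang-Baxter equation: the two ways to reverse three adjacent letters, starting with the first
  or with the last two of them, agree. Columns merely travel along and need not be distinct.\<close>

lemma braid:
  "cross x y (\<lambda>y' x'. cross x' z (\<lambda>z' x''. cross y' z' (\<lambda>z'' y''. f z'' y'' x'')))
   = cross y z (\<lambda>z' y'. cross x z' (\<lambda>z'' x'. cross x' y' (\<lambda>y'' x''. f z'' y'' x'')))"
  using braid_coords[of "fst x" "snd x" "fst y" "snd y" "fst z" "snd z" f] by simp

end

section \<open>Inserting letters into column-sorted words\<close>

context
  fixes k r :: nat
begin

lemma cross_cong:
  assumes "\<And>a b. f (a, snd y) (b, snd x) = g (a, snd y) (b, snd x)"
  shows "cross k r x y f = cross k r x y g"
  using assms[of "fst y" "fst x"] assms[of "fst x" "fst y"] by (simp add: cross_def)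

text \<open>The value of \<open>f\<close> on the column-sorted form of \<open>x w\<close>, for column-sorted \<open>w\<close>. The recursion is
  structural: after the exchange the letter in front has the smallest column.\<close>

fun insert_letter :: "letter \<Rightarrow> letter list \<Rightarrow> (letter list \<Rightarrow> ratfun) \<Rightarrow> ratfun" where
  "insert_letter x [] f = f [x]"
| "insert_letter x (y # w) f =
    (if snd x \<le> snd y then f (x # y # w)
     else cross k r x y (\<lambda>y' x'. insert_letter x' w (\<lambda>v. f (y' # v))))"

text \<open>The letters of the first word are inserted into the second one, the last letter first.\<close>

fun insert_word :: "letter list \<Rightarrow> letter list \<Rightarrow> (letter list \<Rightarrow> ratfun) \<Rightarrow> ratfun" where
  "insert_word [] u f = f u"
| "insert_word (x # w) u f = insert_word w u (\<lambda>v. insert_letter x v f)"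

lemma insert_letter_linear:
  "insert_letter x u (\<lambda>v. c * f v + d * g v) = c * insert_letter x u f + d * insert_letter x u g"
  by (induction u arbitrary: x f g) (simp_all add: cross_def algebra_simps)

lemma insert_letter_scale: "insert_letter x u (\<lambda>v. c * f v) = c * insert_letter x u f"
  using insert_letter_linear[of x u c f 0 f] by simp

lemma insert_letter_cross:
  "insert_letter x u (\<lambda>v. cross k r y z (\<lambda>z' y'. f z' y' v)) = cross k r y z (\<lambda>z' y'. insert_letter x u (f z' y'))"
  by (simp add: cross_def insert_letter_linear)

lemma insert_word_linear:
  "insert_word w u (\<lambda>v. c * f v + d * g v) = c * insert_word w u f + d * insert_word w u g"
  by (induction w arbitrary: f g) (simp_all add: insert_letter_linear)

lemma insert_word_append: "insert_word (w @ w') u f = insert_word w' u (\<lambda>v. insert_word w v f)"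
  by (induction w arbitrary: f) simp_all

text \<open>Insertion yields only words whose first letter has a column at least the minimum of that of \<open>x\<close> and
  that of the old first letter, so that only the values of \<open>f\<close> on such words matter.\<close>

lemma insert_letter_cong:
  assumes "\<And>y v. min (snd x) c \<le> snd y \<Longrightarrow> f (y # v) = g (y # v)"
    and "u \<noteq> [] \<Longrightarrow> c \<le> snd (hd u)"
  shows "insert_letter x u f = insert_letter x u g"
proof (cases u)
  case Nil
  then show ?thesis using assms(1) by (cases x) auto
next
  case (Cons y w)
  then show ?thesis using assms by (auto intro!: cross_cong)
qed

text \<open>Two letters that both have to pass \<open>z\<close> do so one after the other, which leaves the problem of
  inserting two letters into a shorter word. In the two lemmas on pairs this shape is matched
  against one side of the Yang-Baxter equation.\<close>

lemma insert_pair_push: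
  assumes "snd z < snd x" "snd z < snd y"
  shows "insert_word [x, y] (z # w) f
    = cross k r y z (\<lambda>z' y'. cross k r x z' (\<lambda>z'' x'. insert_word [x', y'] w (\<lambda>v. f (z'' # v))))"
proof -
  have "insert_word [x, y] (z # w) f
    = cross k r y z (\<lambda>z' y'. insert_letter y' w (\<lambda>v. insert_letter x (z' # v) f))"
    using assms by simp
  also have "\<dots> = cross k r y z (\<lambda>z' y'. insert_letter y' w
      (\<lambda>v. cross k r x z' (\<lambda>z'' x'. insert_letter x' v (\<lambda>v. f (z'' # v)))))"
    using assms by (intro cross_cong) simp
  finally show ?thesis by (simp add: insert_letter_cross)
qed

text \<open>Insertion respects the exchange rule. If \<open>y\<close> stays in front of \<open>u\<close>, this is the definition of
  inserting \<open>x\<close>. Otherwise both letters pass the first letter of \<open>u\<close>, the induction hypothesis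
  exchanges them afterwards, and the Yang-Baxter equation moves the exchange to the beginning.\<close>

lemma insert_pair_descent:
  assumes "snd y < snd x"
  shows "insert_word [x, y] u f = cross k r x y (\<lambda>y' x'. insert_word [y', x'] u f)"
  using assms
proof (induction u arbitrary: x y f)
  case Nil
  then show ?case by (auto intro!: cross_cong)
next
  case (Cons z w)
  show ?case
  proof (cases "snd y \<le> snd z")
    case True
    have "insert_word [x, y] (z # w) f = cross k r x y (\<lambda>y' x'. insert_letter x' (z # w) (\<lambda>v. f (y' # v)))"
      using True Cons.prems by simp
    also have "\<dots> = cross k r x y (\<lambda>y' x'. insert_letter x' (z # w) (\<lambda>v. insert_letter y' v f))"
      using True Cons.prems
      by (intro cross_cong insert_letter_cong[where c = "snd y"]) auto
    finally show ?thesis by simp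
  next
    case False
    then have z: "snd z < snd y" "snd z < snd x" using Cons.prems by auto
    have "insert_word [x, y] (z # w) f
      = cross k r y z (\<lambda>z' y'. cross k r x z' (\<lambda>z'' x'. insert_word [x', y'] w (\<lambda>v. f (z'' # v))))"
      by (rule insert_pair_push) (use z in auto)
    also have "\<dots> = cross k r y z (\<lambda>z' y'. cross k r x z' (\<lambda>z'' x'.
        cross k r x' y' (\<lambda>y'' x''. insert_word [y'', x''] w (\<lambda>v. f (z'' # v)))))"
      by (intro cross_cong Cons.IH) (use Cons.prems in auto)
    also have "\<dots> = cross k r x y (\<lambda>y' x'. cross k r x' z (\<lambda>z' x''. cross k r y' z' (\<lambda>z'' y''.
        insert_word [y'', x''] w (\<lambda>v. f (z'' # v)))))"
      by (rule braid[symmetric])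
    also have "\<dots> = cross k r x y (\<lambda>y' x'. insert_word [y', x'] (z # w) f)"
      by (intro cross_cong insert_pair_push[symmetric]) (use z in auto)
    finally show ?thesis .
  qed
qed

text \<open>The exchange operator acts on adjacent letters of one column \<open>c\<close> by the scalar \<open>q\<^sub>c\<close>. For functions
  on words this says the same as the defining relations within columns, but in a form to which
  the Yang-Baxter equation applies.\<close>

definition column_symmetric :: "(letter list \<Rightarrow> ratfun) \<Rightarrow> bool" where
  "column_symmetric f \<longleftrightarrow> (\<forall>v x y w. snd x = snd y \<longrightarrow>
     cross k r x y (\<lambda>y' x'. f (v @ y' # x' # w)) = q_index r (snd x) * f (v @ x # y # w))"

lemma column_symmetricD:
  assumes "column_symmetric f" "snd x = snd y"
  shows "cross k r x y (\<lambda>y' x'. f (v @ y' # x' # w)) = q_index r (snd x) * f (v @ x # y # w)"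
  using assms unfolding column_symmetric_def by blast

lemma column_symmetric_Cons: "column_symmetric f \<Longrightarrow> column_symmetric (\<lambda>v. f (z # v))"
  using column_symmetricD[of f _ _ "z # _"] by (simp add: column_symmetric_def)

text \<open>A letter either stays in front of both letters of a pair from one column or passes both of
  them. In the second case, the exchange within the pair may be done after the passage instead of
  before it, by the Yang-Baxter equation; there it is governed by the symmetry of \<open>f\<close>.\<close>

lemma column_symmetric_insert_letter:
  assumes "column_symmetric f"
  shows "column_symmetric (\<lambda>u. insert_letter z u f)"
  unfolding column_symmetric_def
proof (intro allI impI)
  fix v w :: "letter list" and x y :: letter
  assume xy: "snd x = snd y"
  show "cross k r x y (\<lambda>y' x'. insert_letter z (v @ y' # x' # w) f)
    = q_index r (snd x) * insert_letter z (v @ x # y # w) f"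
    using assms
  proof (induction v arbitrary: z f)
    case Nil
    show ?case
    proof (cases "snd z \<le> snd x")
      case True
      then have "cross k r x y (\<lambda>y' x'. insert_letter z ([] @ y' # x' # w) f)
        = cross k r x y (\<lambda>y' x'. f ([z] @ y' # x' # w))"
        using xy by (intro cross_cong) simp
      then show ?thesis
        using column_symmetricD[OF Nil xy, of "[z]" w] True xy by simp
    next
      case False
      let ?g = "\<lambda>a b z. insert_letter z w (\<lambda>u. f (a # b # u))"
      have g: "insert_letter z (a # b # w) f = cross k r z a (\<lambda>a' z'. cross k r z' b (\<lambda>b' z''. ?g a' b' z''))"
        if "snd a = snd x" "snd b = snd x" for a b
        using False that by (auto intro!: cross_cong)
      have "cross k r x y (\<lambda>y' x'. insert_letter z ([] @ y' # x' # w) f)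
         = cross k r x y (\<lambda>y' x'. cross k r z y' (\<lambda>y'' z'. cross k r z' x' (\<lambda>x'' z''. ?g y'' x'' z'')))"
        unfolding append_Nil using xy by (intro cross_cong g) simp_all
      also have "\<dots> = cross k r z x (\<lambda>x' z'. cross k r z' y (\<lambda>y' z''. cross k r x' y' (\<lambda>y'' x''. ?g y'' x'' z'')))"
        by (rule braid[symmetric])
      \<comment> \<open>After the passage the pair is in front, where the symmetry of \<open>f\<close> applies under \<open>?g\<close>.\<close>
      also have "\<dots> = cross k r z x (\<lambda>x' z'. cross k r z' y (\<lambda>y' z''. q_index r (snd x) * ?g x' y' z''))"
      proof (intro cross_cong)
        fix a b a' b'
        show "cross k r (a, snd x) (a', snd y) (\<lambda>y'' x''. ?g y'' x'' (b', snd (b, snd z)))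
          = q_index r (snd x) * ?g (a, snd x) (a', snd y) (b', snd (b, snd z))"
          using column_symmetricD[OF Nil, of "(a, snd x)" "(a', snd y)" "[]"] xy
          by (simp only: insert_letter_cross[symmetric] append_Nil snd_conv insert_letter_scale)
      qed
      also have "\<dots> = q_index r (snd x) * insert_letter z (x # y # w) f"
        using xy by (subst g) (simp_all add: cross_def algebra_simps)
      finally show ?thesis by simp
    qed
  next
    case (Cons t v)
    show ?case
    proof (cases "snd z \<le> snd t")
      case True
      then show ?thesis
        using column_symmetricD[OF Cons.prems xy, of "z # t # v" w] by simp
    next
      case False
      have "cross k r x y (\<lambda>y' x'. insert_letter z ((t # v) @ y' # x' # w) f)
        = cross k r z t (\<lambda>t' z'. cross k r x y (\<lambda>y' x'. insert_letter z' (v @ y' # x' # w) (\<lambda>u. f (t' # u))))"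
        using False by (simp add: cross_def algebra_simps)
      also have "\<dots> = cross k r z t (\<lambda>t' z'. q_index r (snd x) * insert_letter z' (v @ x # y # w) (\<lambda>u. f (t' # u)))"
        by (simp add: Cons.IH column_symmetric_Cons Cons.prems)
      finally show ?thesis
        using False by (simp add: cross_def algebra_simps)
    qed
  qed
qed

lemma column_symmetric_insert_word:
  "column_symmetric f \<Longrightarrow> column_symmetric (\<lambda>u. insert_word w u f)"
  by (induction w arbitrary: f) (simp_all add: column_symmetric_insert_letter)

text \<open>The counterpart of \<open>insert_pair_descent\<close> for equal columns: when both letters pass \<open>z\<close>, the
  Yang-Baxter equation postpones the exchange between them until after the passage, where the
  induction hypothesis applies.\<close>

lemma insert_pair_same_column:
  assumes "column_symmetric f" "snd x = snd y"
  shows "cross k r x y (\<lambda>y' x'. insert_word [y', x'] u f) = q_index r (snd x) * insert_word [x, y] u f"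
  using assms
proof (induction u arbitrary: x y f)
  case Nil
  then show ?case
    using column_symmetricD[OF Nil, of "[]" "[]"] by (simp add: cross_def)
next
  case (Cons z w)
  show ?case
  proof (cases "snd x \<le> snd z")
    case True
    then show ?thesis
      using column_symmetricD[OF Cons.prems, of "[]" "z # w"] Cons.prems(2) by (simp add: cross_def)
  next
    case False
    then have z: "snd z < snd y" "snd z < snd x" using Cons.prems by auto
    have "cross k r x y (\<lambda>y' x'. insert_word [y', x'] (z # w) f)
      = cross k r x y (\<lambda>y' x'. cross k r x' z (\<lambda>z' x''. cross k r y' z' (\<lambda>z'' y''.
        insert_word [y'', x''] w (\<lambda>v. f (z'' # v)))))"
      by (intro cross_cong insert_pair_push) (use z in auto)
    also have "\<dots> = cross k r y z (\<lambda>z' y'. cross k r x z' (\<lambda>z'' x'.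
        cross k r x' y' (\<lambda>y'' x''. insert_word [y'', x''] w (\<lambda>v. f (z'' # v)))))"
      by (rule braid)
    also have "\<dots> = cross k r y z (\<lambda>z' y'. cross k r x z' (\<lambda>z'' x'.
        q_index r (snd x) * insert_word [x', y'] w (\<lambda>v. f (z'' # v))))"
    proof (intro cross_cong)
      fix a b a' b'
      show "cross k r (b', snd x) (b, snd y) (\<lambda>y'' x''. insert_word [y'', x''] w (\<lambda>v. f ((a', snd (a, snd z)) # v)))
        = q_index r (snd x) * insert_word [(b', snd x), (b, snd y)] w (\<lambda>v. f ((a', snd (a, snd z)) # v))"
        using Cons.IH[of "\<lambda>v. f ((a', snd (a, snd z)) # v)" "(b', snd x)" "(b, snd y)"]
          Cons.prems column_symmetric_Cons by simp
    qed
    also have "\<dots> = q_index r (snd x) * insert_word [x, y] (z # w) f"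
      by (subst insert_pair_push) (use z in \<open>simp_all add: cross_def algebra_simps\<close>)
    finally show ?thesis .
  qed
qed

end

section \<open>Coefficients within columns\<close>

context
  fixes k r :: nat
begin

text \<open>The scalar gained when \<open>x\<close>, standing somewhere to the left of \<open>y\<close>, is brought into order with it by
  the relations within a column. It is 0 for a repeated odd letter. Letters of different columns
  are already in order in the words to which this is applied.\<close>

definition order_weight :: "letter \<Rightarrow> letter \<Rightarrow> ratfun" where
  "order_weight x y =
    (if snd x \<noteq> snd y \<or> fst x < fst y then 1
     else if fst x = fst y then of_bool (even (deg k r x))
     else (- 1) ^ (deg k r x * deg k r y) * q_index r (snd x))"

fun word_weight :: "letter list \<Rightarrow> ratfun" where
  "word_weight [] = 1"
| "word_weight (x # w) = prod_list (map (order_weight x) w) * word_weight w"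

text \<open>The coefficient of the ordered monomial with content \<open>M\<close> in a column-sorted word, where only
  the relations within columns are used.\<close>

definition monomial_coeff :: "letter multiset \<Rightarrow> letter list \<Rightarrow> ratfun" where
  "monomial_coeff M w = (if mset w = M then word_weight w else 0)"

lemma word_weight_append:
  "word_weight (v @ w) = word_weight v * word_weight w * prod_list (map (\<lambda>x. prod_list (map (order_weight x) w)) v)"
  by (induction v) (simp_all add: mult_ac)

text \<open>Compatibility of the weights with the exchange rule, for letters that are adjacent in a column;
  when \<open>x\<close> has the larger row, this amounts to \<open>q\<^sub>c - q\<^sub>c\<^sup>-\<^sup>1 = \<plusminus> (q - q\<^sup>-\<^sup>1)\<close> for the
  common column \<open>c\<close>.\<close>

lemma order_weight_cross:
  assumes "snd x = snd y"
  shows "swap_coeff k r x y * order_weight y x + hold_coeff k r x y * order_weight x y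
    = q_index r (snd x) * order_weight x y"
proof -
  obtain a b c where [simp]: "x = (a, c)" "y = (b, c)"
    using assms by (metis prod.collapse)
  have q: "q * inverse q = 1" using q_nonzero by simp
  consider "a < b" | "a = b" | "b < a" by (rule linorder_cases)
  then show ?thesis
    using parity_cases[of k a] parity_cases[of k b] parity_cases[of r c] q
    by cases (auto simp: swap_coeff_def hold_coeff_def order_weight_def deg_def q_index_def algebra_simps)
qed

text \<open>Exchanging adjacent letters \<open>x\<close>, \<open>y\<close> changes the weight of a word only in the factor that belongs to
  this pair.\<close>

lemma column_symmetric_monomial_coeff: "column_symmetric k r (monomial_coeff M)"
  unfolding column_symmetric_def
proof (intro allI impI)
  fix v w :: "letter list" and x y :: letter
  assume xy: "snd x = snd y"
  define C where "C = word_weight v * word_weight w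
    * prod_list (map (\<lambda>z. order_weight z x * order_weight z y * prod_list (map (order_weight z) w)) v)
    * prod_list (map (order_weight x) w) * prod_list (map (order_weight y) w)"
  have 1: "word_weight (v @ x # y # w) = order_weight x y * C"
    by (simp add: C_def word_weight_append mult_ac)
  have 2: "word_weight (v @ y # x # w) = order_weight y x * C"
    by (simp add: C_def word_weight_append mult_ac)
  have "cross k r x y (\<lambda>y' x'. monomial_coeff M (v @ y' # x' # w))
    = (if mset (v @ x # y # w) = M then (swap_coeff k r x y * order_weight y x + hold_coeff k r x y * order_weight x y) * C else 0)"
  proof -
    have "(fst x, snd y) = x" "(fst y, snd x) = y" using xy by (simp_all add: prod_eq_iff)
    then show ?thesis
      by (simp add: cross_def monomial_coeff_def 1 2 distrib_right mult.assoc add_mset_commute)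
  qed
  also have "\<dots> = q_index r (snd x) * monomial_coeff M (v @ x # y # w)"
    by (simp add: monomial_coeff_def 1 order_weight_cross[OF xy])
  finally show "cross k r x y (\<lambda>y' x'. monomial_coeff M (v @ y' # x' # w))
    = q_index r (snd x) * monomial_coeff M (v @ x # y # w)" .
qed

text \<open>The exchange rule for decreasing columns and the eigenvalue condition within columns imply the five
  families of defining relations. For an odd letter, exchanging it with itself multiplies by
  \<open>- q\<^sub>c\<^sup>-\<^sup>1\<close>, while the eigenvalue condition multiplies by \<open>q\<^sub>c\<close>; hence the square is 0.\<close>

lemma defining_relations:
  fixes G :: "letter \<Rightarrow> letter \<Rightarrow> ratfun"
  defines "p \<equiv> parity k" and "p' \<equiv> parity r"
  assumes descent: "\<And>x y. snd y < snd x \<Longrightarrow> G x y = cross k r x y G"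
    and same_column: "\<And>x y. snd x = snd y \<Longrightarrow> cross k r x y G = q_index r (snd x) * G x y"
  shows "odd (p a + p' b) \<Longrightarrow> G (a, b) (a, b) = 0"
    and "b < a \<Longrightarrow> G (a, c) (b, c) = (- 1) ^ ((p a + p' c) * (p b + p' c)) * q_index r c * G (b, c) (a, c)"
    and "c < b \<Longrightarrow> G (a, b) (a, c) = (- 1) ^ ((p a + p' c) * (p a + p' b)) * q_index k a * G (a, c) (a, b)"
    and "b < a \<Longrightarrow> c < d \<Longrightarrow> G (a, c) (b, d) = (- 1) ^ ((p a + p' c) * (p b + p' d)) * G (b, d) (a, c)"
    and "b < a \<Longrightarrow> d < c \<Longrightarrow> G (a, c) (b, d) = (- 1) ^ ((p a + p' c) * (p b + p' d)) * G (b, d) (a, c)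
      + (- 1) ^ (p a * (p b + p' d) + p b * p' d) * (q - inverse q) * G (b, c) (a, d)"
proof -
  have sign: "(- 1) ^ n * ((- 1) ^ n * u) = u" for n :: nat and u :: ratfun
    by (simp flip: mult.assoc power_add)
  {
    assume odd: "odd (p a + p' b)"
    have q: "q + inverse q \<noteq> 0"
    proof
      assume "q + inverse q = 0"
      then have "q * (q + inverse q) = 0" by simp
      then have "q * q = - 1" using q_nonzero by (simp add: distrib_left add_eq_0_iff2)
      then show False by (rule q_square_ne_minus_one[THEN notE])
    qed
    have eq1: "cross k r (a, b) (a, b) G = q_index r b * G (a, b) (a, b)"
      using same_column by simp
    have eq2: "cross k r (a, b) (a, b) G = - q_index k a * G (a, b) (a, b)"
      using odd by (simp add: cross_def swap_coeff_def hold_coeff_def deg_def p_def p'_def)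
    have "(q_index r b + q_index k a) * G (a, b) (a, b) = 0"
      unfolding distrib_right trans[OF eq1[symmetric] eq2] by simp
    moreover have "q_index r b + q_index k a = q + inverse q"
      using odd by (auto simp: q_index_alt parity_def p_def p'_def split: if_splits)
    ultimately show "G (a, b) (a, b) = 0" using q by simp
  }
  {
    assume "b < a"
    then have "(- 1) ^ ((p a + p' c) * (p b + p' c)) * G (a, c) (b, c) = q_index r c * G (b, c) (a, c)"
      using same_column[of "(b, c)" "(a, c)"]
      by (simp add: cross_def swap_coeff_def hold_coeff_def deg_def p_def p'_def mult.commute)
    then show "G (a, c) (b, c) = (- 1) ^ ((p a + p' c) * (p b + p' c)) * q_index r c * G (b, c) (a, c)"
      using sign[of "(p a + p' c) * (p b + p' c)" "G (a, c) (b, c)"] by (simp add: mult.assoc)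
  }
  {
    assume "c < b"
    then show "G (a, b) (a, c) = (- 1) ^ ((p a + p' c) * (p a + p' b)) * q_index k a * G (a, c) (a, b)"
      using descent[of "(a, c)" "(a, b)"]
      by (simp add: cross_def swap_coeff_def hold_coeff_def deg_def p_def p'_def mult.commute)
  }
  have commuting: "G (a, c) (b, d) = (- 1) ^ ((p a + p' c) * (p b + p' d)) * G (b, d) (a, c)"
    if "b < a" "c < d" for a b c d
  proof -
    have "G (b, d) (a, c) = (- 1) ^ ((p a + p' c) * (p b + p' d)) * G (a, c) (b, d)"
      using that descent[of "(a, c)" "(b, d)"]
      by (simp add: cross_def swap_coeff_def hold_coeff_def deg_def p_def p'_def mult.commute)
    then show ?thesis by (simp add: sign)
  qed
  then show "b < a \<Longrightarrow> c < d \<Longrightarrow> G (a, c) (b, d) = (- 1) ^ ((p a + p' c) * (p b + p' d)) * G (b, d) (a, c)" .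
  {
    assume ba: "b < a" and dc: "d < c"
    have "G (a, c) (b, d) = (- 1) ^ ((p a + p' c) * (p b + p' d)) * G (b, d) (a, c)
      + (- 1) ^ (p a * (p' c + p' d) + p' c * p' d) * (q - inverse q) * G (a, d) (b, c)"
      using ba descent[of "(b, d)" "(a, c)"] dc
      by (simp add: cross_def swap_coeff_def hold_coeff_def deg_def p_def p'_def)
    also have "G (a, d) (b, c) = (- 1) ^ ((p a + p' d) * (p b + p' c)) * G (b, c) (a, d)"
      by (rule commuting[OF ba dc])
    also have "(- 1) ^ (p a * (p' c + p' d) + p' c * p' d) * (q - inverse q) * \<dots>
      = (- 1) ^ (p a * (p b + p' d) + p b * p' d) * (q - inverse q) * G (b, c) (a, d)"
      using parity_cases[of k a] parity_cases[of k b] parity_cases[of r c] parity_cases[of r d]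
      unfolding p_def p'_def by (elim disjE) (simp_all add: left_diff_distrib)
    finally show "G (a, c) (b, d) = (- 1) ^ ((p a + p' c) * (p b + p' d)) * G (b, d) (a, c)
      + (- 1) ^ (p a * (p b + p' d) + p b * p' d) * (q - inverse q) * G (b, c) (a, d)" .
  }
qed

end

section \<open>Normal form coefficients vanish on the relations\<close>

context
  fixes k r :: nat
begin

text \<open>The order in which letters may follow each other in a monomial. It is reflexive only at even
  letters, so that sortedness excludes repeated odd letters.\<close>

definition letter_le :: "letter \<Rightarrow> letter \<Rightarrow> bool" where
  "letter_le x y \<longleftrightarrow> snd x < snd y \<or>
     snd x = snd y \<and> (fst x < fst y \<or> fst x = fst y \<and> even (deg k r x))"

lemma transp_letter_le: "transp letter_le"
  by (rule transpI) (auto simp: letter_le_def deg_def)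

lemma letter_le_antisym: "letter_le x y \<Longrightarrow> letter_le y x \<Longrightarrow> x = y"
  by (auto simp: letter_le_def prod_eq_iff)

lemma word_weight_sorted: "sorted_wrt letter_le w \<Longrightarrow> word_weight k r w = 1"
proof (induction w)
  case (Cons x w)
  then have "map (order_weight k r x) w = map (\<lambda>_. 1) w"
    by (auto simp: letter_le_def order_weight_def)
  then show ?case using Cons by (simp add: map_replicate_const)
qed simp

lemma insert_word_sorted: "sorted_wrt letter_le w \<Longrightarrow> insert_word k r w [] f = f w"
proof (induction w arbitrary: f)
  case (Cons x w)
  then have "insert_letter k r x w f = f (x # w)"
    by (cases w) (auto simp: letter_le_def)
  then show ?case using Cons by simp
qed simp

text \<open>The separating functionals: sort the columns by insertion into the empty word, then read off the
  coefficient of the monomial with content \<open>M\<close>.\<close>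

definition normal_form_coeff :: "letter multiset \<Rightarrow> letter free_word \<Rightarrow> ratfun" where
  "normal_form_coeff M w = insert_word k r (letters w) [] (monomial_coeff k r M)"

lemma normal_form_coeff_sorted:
  "sorted_wrt letter_le (letters w) \<Longrightarrow> normal_form_coeff M w = (if mset (letters w) = M then 1 else 0)"
  by (simp add: normal_form_coeff_def insert_word_sorted monomial_coeff_def word_weight_sorted)

text \<open>The letters of the word \<open>v\<close> to the right of the pair are inserted first, and those of \<open>u\<close> last; so the latter
  form a function of the word obtained by inserting the pair, which inherits column symmetry.\<close>

lemma normal_form_coeff_pair:
  fixes u v :: "letter free_word" and M :: "letter multiset"
  defines "G \<equiv> (\<lambda>x y. normal_form_coeff M (u + Word [x, y] + v))"
  shows "snd y < snd x \<Longrightarrow> G x y = cross k r x y G"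
    and "snd x = snd y \<Longrightarrow> cross k r x y G = q_index r (snd x) * G x y"
proof -
  let ?f = "\<lambda>t. insert_word k r (letters u) t (monomial_coeff k r M)"
  have G: "G x y = insert_word k r (letters v) [] (\<lambda>t. insert_word k r [x, y] t ?f)" for x y
    by (simp add: G_def normal_form_coeff_def plus_free_word_def insert_word_append)
  have crossG: "cross k r x y G
      = insert_word k r (letters v) [] (\<lambda>t. cross k r x y (\<lambda>y' x'. insert_word k r [y', x'] t ?f))" for x y
    by (simp only: cross_def G insert_word_linear)
  show "G x y = cross k r x y G" if "snd y < snd x"
    unfolding crossG G using insert_pair_descent[OF that, of k r _ ?f] by simp
  show "cross k r x y G = q_index r (snd x) * G x y" if xy: "snd x = snd y"
  proof -
    have "column_symmetric k r ?f"
      by (intro column_symmetric_insert_word column_symmetric_monomial_coeff)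
    from insert_pair_same_column[OF this xy]
    have "cross k r x y G
        = insert_word k r (letters v) [] (\<lambda>t. q_index r (snd x) * insert_word k r [x, y] t ?f)"
      unfolding crossG by simp
    also have "\<dots> = q_index r (snd x) * G x y"
      using insert_word_linear[of k r "letters v" "[]" "q_index r (snd x)" "\<lambda>t. insert_word k r [x, y] t ?f" 0]
      by (simp add: G)
    finally show ?thesis .
  qed
qed

lemma normal_form_coeff_relations:
  assumes "p \<in> relations k l r s"
  shows "pairing (normal_form_coeff M) (Poly_Mapping.single u 1 * p * Poly_Mapping.single v 1) = 0"
proof -
  define T where "T = (\<lambda>p. pairing (normal_form_coeff M) (Poly_Mapping.single u 1 * p * Poly_Mapping.single v 1))"
  define G where "G = (\<lambda>x y. normal_form_coeff M (u + Word [x, y] + v))"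
  have T_gen: "T (gen a b * gen c d) = G (a, b) (c, d)" for a b c d
    by (simp add: T_def G_def gen_def mult_single pairing_single plus_free_word_def)
  have T_diff: "T (p - p') = T p - T p'" for p p'
    by (simp add: T_def left_diff_distrib right_diff_distrib pairing_diff)
  have T_add: "T (p + p') = T p + T p'" for p p'
    by (simp add: T_def distrib_left distrib_right pairing_add)
  have T_scale: "T (c *\<^sub>K p) = c * T p" for c p
  proof -
    have "Poly_Mapping.single u 1 * (c *\<^sub>K p) * Poly_Mapping.single v 1
        = c *\<^sub>K (Poly_Mapping.single u 1 * p * Poly_Mapping.single v 1)"
      unfolding scale_conv_mult
      by (simp only: mult.assoc[symmetric] scalar_central[of "Poly_Mapping.single u 1"])
    then show ?thesis by (simp only: T_def pairing_scale)
  qed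
  have descent: "G x y = cross k r x y G" if "snd y < snd x" for x y
    unfolding G_def using that by (rule normal_form_coeff_pair)
  have same_column: "cross k r x y G = q_index r (snd x) * G x y" if "snd x = snd y" for x y
    unfolding G_def using that by (rule normal_form_coeff_pair)
  note rels = defining_relations[of G k r, OF descent same_column]
  have "T p = 0"
    using assms unfolding relations_def Let_def
    by (elim UnE CollectE exE conjE)
      (simp_all only: power2_eq_square T_gen T_diff T_add T_scale rels mult.assoc diff_self not_False_eq_True)
  then show ?thesis by (simp add: T_def)
qed

end

section \<open>Sorted words and exponent matrices\<close>

lemma sorted_wrt_mset_unique:
  assumes "sorted_wrt R v" "sorted_wrt R w" "mset v = mset w" "\<And>x y. R x y \<Longrightarrow> R y x \<Longrightarrow> x = y"
  shows "v = w"
  using assms(1-3)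
proof (induction v arbitrary: w)
  case (Cons x v)
  then obtain y w' where w: "w = y # w'" by (cases w) auto
  have "x = y"
  proof (rule ccontr)
    assume "x \<noteq> y"
    then have "y \<in> set v" "x \<in> set w'"
      using mset_eq_setD[OF Cons.prems(3)] w by auto
    then show False
      using Cons.prems(1,2) w assms(4) \<open>x \<noteq> y\<close> by auto
  qed
  then show ?case using Cons w by auto
qed simp

lemma not_sorted_wrt_adjacent:
  assumes "\<not> sorted_wrt R w" "transp R"
  obtains u x y v where "w = u @ x # y # v" "\<not> R x y"
proof -
  have "\<not> successively R w"
    using assms successively_conv_sorted_wrt[of R w] by (auto simp: transp_def)
  then have "\<exists>u x y v. w = u @ x # y # v \<and> \<not> R x y"
  proof (induction R w rule: successively.induct)
    case (3 R x y w)
    then show ?case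
      by (cases "R x y") (simp, metis append_Cons, metis append_Nil)
  qed simp_all
  then show ?thesis using that by blast
qed

lemma sorted_wrt_concat_map:
  assumes "sorted_wrt S xs"
    and "\<And>x. x \<in> set xs \<Longrightarrow> sorted_wrt R (f x)"
    and "\<And>x y a b. S x y \<Longrightarrow> a \<in> set (f x) \<Longrightarrow> b \<in> set (f y) \<Longrightarrow> R a b"
  shows "sorted_wrt R (concat (map f xs))"
  using assms(1,2) by (induction xs) (auto simp: sorted_wrt_append intro: assms(3))

definition matrix_word :: "nat \<Rightarrow> nat \<Rightarrow> nat \<Rightarrow> nat \<Rightarrow> (nat \<Rightarrow> nat \<Rightarrow> nat) \<Rightarrow> letter list" where
  "matrix_word k l r s m =
    concat (map (\<lambda>b. concat (map (\<lambda>a. replicate (m a b) (a, b)) [1..<Suc (k + l)])) [1..<Suc (r + s)])"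

lemma set_matrix_word: "set (matrix_word k l r s m) \<subseteq> index_set k l \<times> index_set r s"
  by (auto simp: matrix_word_def index_set_def)

lemma count_concat_map: "count (mset (concat (map f xs))) z = (\<Sum>x\<leftarrow>xs. count (mset (f x)) z)"
  by (induction xs) simp_all

lemma count_matrix_word:
  "count (mset (matrix_word k l r s m)) (a, b)
    = (if a \<in> index_set k l \<and> b \<in> index_set r s then m a b else 0)"
proof -
  have "count (mset (matrix_word k l r s m)) (a, b)
    = (\<Sum>b'\<in>index_set r s. if b' = b then \<Sum>a'\<in>index_set k l. if a' = a then m a b else 0 else 0)"
    unfolding matrix_word_def count_concat_map index_set_def
    by (subst sum_list_distinct_conv_sum_set, simp)+
      (intro sum.cong; auto simp: count_concat_map sum_list_distinct_conv_sum_set intro!: sum.cong sum.neutral)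
  also have "\<dots> = (if a \<in> index_set k l \<and> b \<in> index_set r s then m a b else 0)"
    by (simp add: sum.delta index_set_def)
  finally show ?thesis .
qed

lemma sorted_matrix_word:
  assumes "m \<in> exponent_matrices k l r s"
  shows "sorted_wrt (letter_le k r) (matrix_word k l r s m)"
  unfolding matrix_word_def
proof (rule sorted_wrt_concat_map[where S = "(<)"])
  fix b assume b: "b \<in> set [1..<Suc (r + s)]"
  show "sorted_wrt (letter_le k r) (concat (map (\<lambda>a. replicate (m a b) (a, b)) [1..<Suc (k + l)]))"
  proof (rule sorted_wrt_concat_map[where S = "(<)"])
    fix a assume a: "a \<in> set [1..<Suc (k + l)]"
    have "a \<in> index_set k l" "b \<in> index_set r s"
      using a b by (auto simp: index_set_def)
    then have "even (deg k r (a, b)) \<or> m a b \<in> {0, 1}"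
      using assms unfolding exponent_matrices_def deg_def fst_conv snd_conv by blast
    then show "sorted_wrt (letter_le k r) (replicate (m a b) (a, b))"
      by (auto simp: sorted_wrt_iff_nth_less letter_le_def)
  qed (auto simp: letter_le_def simp del: upt_Suc)
qed (auto simp: letter_le_def simp del: upt_Suc)

text \<open>The exponents of a sorted word are its letter multiplicities; odd letters occur at most once because
  they are not comparable to themselves.\<close>

lemma matrix_word_surj:
  assumes w: "sorted_wrt (letter_le k r) w" "set w \<subseteq> index_set k l \<times> index_set r s"
  obtains m where "m \<in> exponent_matrices k l r s" "w = matrix_word k l r s m"
proof
  define m where "m = (\<lambda>a b. count (mset w) (a, b))"
  have "count_list w (a, b) \<le> 1" if "odd (deg k r (a, b))" for a b
    using w(1) that
  proof (induction w)
    case (Cons x w)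
    then show ?case
      by (cases "x = (a, b)") (auto simp: letter_le_def count_list_0_iff)
  qed simp
  then have "count (mset w) (a, b) \<in> {0, 1}" if "odd (deg k r (a, b))" for a b
    using that by (fastforce simp: count_mset le_Suc_eq)
  moreover have "count (mset w) (a, b) = 0" if "\<not> (a \<in> index_set k l \<and> b \<in> index_set r s)" for a b
    using w(2) that by (auto simp: count_eq_zero_iff)
  ultimately show m: "m \<in> exponent_matrices k l r s"
    unfolding exponent_matrices_def m_def deg_def by auto
  show "w = matrix_word k l r s m"
  proof (rule sorted_wrt_mset_unique[OF w(1) sorted_matrix_word[OF m] _ letter_le_antisym])
    show "mset w = mset (matrix_word k l r s m)"
    proof (rule multiset_eqI)
      fix x
      show "count (mset w) x = count (mset (matrix_word k l r s m)) x"
        using m by (cases x) (auto simp: count_matrix_word m_def exponent_matrices_def)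
    qed
  qed
qed

lemma inj_on_matrix_word: "inj_on (matrix_word k l r s) (exponent_matrices k l r s)"
proof (rule inj_onI, rule ext, rule ext)
  fix m m' a b
  assume "m \<in> exponent_matrices k l r s" "m' \<in> exponent_matrices k l r s"
    "matrix_word k l r s m = matrix_word k l r s m'"
  then show "m a b = m' a b"
    using count_matrix_word[of k l r s m a b] count_matrix_word[of k l r s m' a b]
    unfolding exponent_matrices_def by (auto split: if_splits)
qed

section \<open>Sorted words span\<close>

text \<open>Letters are compared first by column, then by row, hence the swap of components.\<close>

abbreviation letter_less :: "(letter \<times> letter) set" where
  "letter_less \<equiv> inv_image (less_than <*lex*> less_than) prod.swap"

text \<open>For each way in which two adjacent letters can be out of order there is a relation that rewrites
  the pair. If the columns decrease and the rows increase, the relation is the one for the pair in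
  the opposite order, multiplied by a sign.\<close>

lemma reduce_pair:
  fixes k l r s :: nat
  defines "X \<equiv> index_set k l \<times> index_set r s"
  defines "I \<equiv> Idl\<^bsub>free_algebra X :: (ratfun, _) module\<^esub> relations k l r s"
  assumes xy: "x \<in> X" "y \<in> X" "\<not> letter_le k r x y"
  shows "\<exists>n. Poly_Mapping.keys n \<subseteq> {Word [z, t] |z t. z \<in> X \<and> t \<in> X \<and> (z, x) \<in> letter_less}
    \<and> Poly_Mapping.single (Word [x, y]) 1 - n \<in> I"
    (is "\<exists>n. ?small n \<and> _")
proof -
  obtain a c b d where x: "x = (a, c)" and y: "y = (b, d)" by (metis surj_pair)
  have ab: "a \<in> index_set k l" "b \<in> index_set k l" "c \<in> index_set r s" "d \<in> index_set r s"
    using xy by (auto simp: X_def x y)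
  have I: "ideal I (free_algebra X)"
    unfolding I_def X_def by (rule ideal_relations)
  have rel: "p \<in> I" if "p \<in> relations k l r s" for p
    using ring.genideal_self[OF ring_free_algebra relations_closed] that unfolding I_def X_def by blast
  have gg: "gen a c * gen b d = Poly_Mapping.single (Word [(a, c), (b, d)]) 1" for a b c d
    by (simp add: gen_def mult_single plus_free_word_def)
  have scale_gg: "u *\<^sub>K Poly_Mapping.single e 1 = Poly_Mapping.single e u" for e :: "letter free_word" and u :: ratfun
    by (simp add: scale_conv_mult mult_single)
  consider "c = d" "a = b" "odd (parity k a + parity r c)" | "c = d" "b < a" | "d < c" "a = b"
    | "d < c" "a < b" | "d < c" "b < a"
    using xy(3) unfolding letter_le_def deg_def x y by fastforce
  then show ?thesis
  proof cases
    case 1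
    have "(gen a c)\<^sup>2 \<in> relations k l r s"
      unfolding relations_def Let_def using 1 ab by blast
    from rel[OF this] show ?thesis
      using 1 by (intro exI[of _ 0]) (simp add: x y gg power2_eq_square)
  next
    case 2
    let ?u = "(- 1) ^ ((parity k a + parity r c) * (parity k b + parity r c)) * q_index r c"
    have "gen a c * gen b c - ?u *\<^sub>K (gen b c * gen a c) \<in> relations k l r s"
      unfolding relations_def Let_def using 2 ab by blast
    from rel[OF this] show ?thesis
      using 2 xy by (intro exI[of _ "Poly_Mapping.single (Word [(b, c), (a, c)]) ?u"])
        (simp add: x y gg scale_gg)
  next
    case 3
    let ?u = "(- 1) ^ ((parity k a + parity r d) * (parity k a + parity r c)) * q_index k a"
    have "gen a c * gen a d - ?u *\<^sub>K (gen a d * gen a c) \<in> relations k l r s"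
      unfolding relations_def Let_def using 3 ab by blast
    from rel[OF this] show ?thesis
      using 3 xy by (intro exI[of _ "Poly_Mapping.single (Word [(a, d), (a, c)]) ?u"])
        (simp add: x y gg scale_gg)
  next
    case 4
    let ?u = "(- 1) ^ ((parity k b + parity r d) * (parity k a + parity r c)) :: ratfun"
    have "gen b d * gen a c - ?u *\<^sub>K (gen a c * gen b d) \<in> relations k l r s"
      unfolding relations_def Let_def using 4 ab by blast
    then have "(- ?u) *\<^sub>K (gen b d * gen a c - ?u *\<^sub>K (gen a c * gen b d)) \<in> I"
      by (intro ideal_scale[OF I] rel)
    also have "(- ?u) *\<^sub>K (gen b d * gen a c - ?u *\<^sub>K (gen a c * gen b d))
      = Poly_Mapping.single (Word [(a, c), (b, d)]) 1 - Poly_Mapping.single (Word [(b, d), (a, c)]) ?u"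
      by (simp add: scale_conv_mult gg right_diff_distrib mult_single single_uminus flip: power_add)
    finally show ?thesis
      using 4 xy by (intro exI[of _ "Poly_Mapping.single (Word [(b, d), (a, c)]) ?u"])
        (simp add: x y)
  next
    case 5
    let ?u = "(- 1) ^ ((parity k a + parity r c) * (parity k b + parity r d)) :: ratfun"
    let ?v = "(- 1) ^ (parity k a * (parity k b + parity r d) + parity k b * parity r d) * (q - inverse q)"
    let ?n = "Poly_Mapping.single (Word [(b, d), (a, c)]) ?u + Poly_Mapping.single (Word [(b, c), (a, d)]) ?v"
    have "gen a c * gen b d - (?u *\<^sub>K (gen b d * gen a c) + ?v *\<^sub>K (gen b c * gen a d)) \<in> relations k l r s"
      unfolding relations_def Let_def using 5 ab by blast
    then have "Poly_Mapping.single (Word [(a, c), (b, d)]) 1 - ?n \<in> I"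
      unfolding gg scale_gg by (rule rel)
    moreover have "Poly_Mapping.keys ?n \<subseteq> {Word [(b, d), (a, c)], Word [(b, c), (a, d)]}"
      using Poly_Mapping.keys_add[of "Poly_Mapping.single (Word [(b, d), (a, c)]) ?u"
          "Poly_Mapping.single (Word [(b, c), (a, d)]) ?v"]
      by (auto split: if_splits)
    then have "?small ?n"
      using 5 ab by (auto simp: x y X_def)
    ultimately show ?thesis unfolding x y by blast
  qed
qed

text \<open>Induction along the length-lexicographic order, in which replacing a disordered pair by pairs with
  smaller first letter is a descent.\<close>

lemma sorted_words_span:
  fixes k l r s :: nat
  defines "X \<equiv> index_set k l \<times> index_set r s"
  defines "I \<equiv> Idl\<^bsub>free_algebra X :: (ratfun, _) module\<^esub> relations k l r s"
  assumes "set w \<subseteq> X"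
  shows "\<exists>n. Poly_Mapping.keys n \<subseteq> {Word w |w. sorted_wrt (letter_le k r) w \<and> set w \<subseteq> X}
    \<and> Poly_Mapping.single (Word w) 1 - n \<in> I"
proof -
  have I: "ideal I (free_algebra X)"
    unfolding I_def X_def by (rule ideal_relations)
  have "wf (lenlex letter_less)"
    by (intro wf_lenlex wf_inv_image wf_lex_prod wf_less_than)
  then show ?thesis using assms(3)
  proof (induction w rule: wf_induct_rule)
    case (less w)
    show ?case
    proof (cases "sorted_wrt (letter_le k r) w")
      case True
      then show ?thesis
        using less.prems ideal_zero[OF I] by (intro exI[of _ "Poly_Mapping.single (Word w) 1"]) auto
    next
      case False
      then obtain u x y v where w: "w = u @ x # y # v" "\<not> letter_le k r x y"
        using not_sorted_wrt_adjacent[OF _ transp_letter_le] by metis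
      then have xy: "x \<in> X" "y \<in> X" using less.prems by auto
      then obtain n where n: "Poly_Mapping.keys n \<subseteq> {Word [z, t] |z t. z \<in> X \<and> t \<in> X \<and> (z, x) \<in> letter_less}"
        "Poly_Mapping.single (Word [x, y]) 1 - n \<in> I"
        using reduce_pair[of x k l r s y] w(2) unfolding I_def X_def by blast
      let ?u = "Poly_Mapping.single (Word u) (1 :: ratfun)"
      let ?v = "Poly_Mapping.single (Word v) (1 :: ratfun)"
      let ?m = "?u * n * ?v"
      have uv: "?u \<in> carrier (free_algebra X)" "?v \<in> carrier (free_algebra X)"
        using less.prems w(1) by (auto intro!: free_algebra_single_closed)
      have "?u * (Poly_Mapping.single (Word [x, y]) 1 - n) * ?v \<in> I"
        using n(2) uv by (intro ideal_mult[OF I])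
      then have wm: "Poly_Mapping.single (Word w) 1 - ?m \<in> I"
        by (simp add: left_diff_distrib right_diff_distrib mult_single plus_free_word_def w(1))
      have "\<exists>n'. Poly_Mapping.keys n' \<subseteq> {Word w |w. sorted_wrt (letter_le k r) w \<and> set w \<subseteq> X}
          \<and> Poly_Mapping.single w' 1 - n' \<in> I" if "w' \<in> Poly_Mapping.keys ?m" for w'
      proof -
        have "w' \<in> {Word u + e + Word v |e. e \<in> Poly_Mapping.keys n}"
          using that Poly_Mapping.keys_mult[of "?u * n" ?v] Poly_Mapping.keys_mult[of ?u n] by fastforce
        then obtain z t where zt: "w' = Word (u @ z # t # v)" "z \<in> X" "t \<in> X" "(z, x) \<in> letter_less"
          using n(1) by (fastforce simp: plus_free_word_def)
        have "irrefl letter_less" by (auto simp: irrefl_def)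
        then have "(u @ z # t # v, w) \<in> lenlex letter_less"
          using zt(4) by (simp add: w(1) lenlex_append2 Cons_lenlex_iff)
        then show ?thesis
          using less.IH[of "u @ z # t # v"] less.prems zt by (simp add: w(1))
      qed
      then obtain n' where "Poly_Mapping.keys n' \<subseteq> {Word w |w. sorted_wrt (letter_le k r) w \<and> set w \<subseteq> X}"
        "?m - n' \<in> I"
        using normal_form_linear[OF I, of ?m] by blast
      then show ?thesis
        using ideal_add[OF I wm] by (intro exI[of _ n']) fastforce
    qed
  qed
qed

section \<open>The monomial basis\<close>

lemma t_monomial_conv_word:
  fixes k l r s :: nat
  defines "F \<equiv> free_algebra (index_set k l \<times> index_set r s) :: (ratfun, _) module"
  assumes m: "m \<in> exponent_matrices k l r s"
  shows "t_monomial k l r s m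
    = (Idl\<^bsub>F\<^esub> relations k l r s) +>\<^bsub>F\<^esub> Poly_Mapping.single (Word (matrix_word k l r s m)) 1"
proof -
  let ?X = "index_set k l \<times> index_set r s"
  let ?I = "Idl\<^bsub>F\<^esub> relations k l r s"
  let ?ws = "concat (map (\<lambda>b. map (\<lambda>a. replicate (m a b) (a, b)) [1..<Suc (k + l)]) [1..<Suc (r + s)])"
  note I = ideal_relations[of k l r s]
  have M: "M_alg k l r s = quotient_algebra F ?I"
    by (simp add: M_alg_def presented_algebra_def F_def)
  have pow: "t_gen k l r s a b [^]\<^bsub>M_alg k l r s\<^esub> m a b
      = ?I +>\<^bsub>F\<^esub> Poly_Mapping.single (Word (replicate (m a b) (a, b))) 1"
    if "a \<in> set [1..<Suc (k + l)]" "b \<in> set [1..<Suc (r + s)]" for a b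
  proof -
    have "concat (replicate n [x]) = replicate n x" for n and x :: letter
      by (induction n) simp_all
    moreover have "a \<in> index_set k l" "b \<in> index_set r s"
      using that by (auto simp: index_set_def)
    ultimately show ?thesis
      using coset_word_power[OF I, of "[(a, b)]" "m a b"]
      by (simp add: M t_gen_def gen_def F_def Let_def)
  qed
  have "[t_gen k l r s a b [^]\<^bsub>M_alg k l r s\<^esub> m a b. b \<leftarrow> [1..<Suc (r + s)], a \<leftarrow> [1..<Suc (k + l)]]
      = map (\<lambda>w. ?I +>\<^bsub>F\<^esub> Poly_Mapping.single (Word w) 1) ?ws"
    unfolding map_concat map_map comp_def
    by (intro arg_cong[where f = concat] map_cong refl pow)
  then have "t_monomial k l r s m = ?I +>\<^bsub>F\<^esub> Poly_Mapping.single (Word (concat ?ws)) 1"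
    unfolding t_monomial_def M F_def
    by (simp only:) (rule coset_words_prod[OF I], auto simp: index_set_def)
  also have "concat ?ws = matrix_word k l r s m"
  proof -
    have "concat (concat xss) = concat (map concat xss)" for xss :: "letter list list list"
      by (induction xss) simp_all
    then show ?thesis by (simp only: matrix_word_def map_map comp_def)
  qed
  finally show ?thesis .
qed

theorem proposition3p8:
  fixes k l r s :: nat
  shows "inj_on (t_monomial k l r s) (exponent_matrices k l r s) \<and>
    vectorspace.basis class_ring (M_alg k l r s)
      {t_monomial k l r s m | m. m \<in> exponent_matrices k l r s}"
proof -
  define X where "X = index_set k l \<times> index_set r s"
  define F where "F = (free_algebra X :: (ratfun, _) module)"
  define I where "I = Idl\<^bsub>F\<^esub> relations k l r s"
  define W where "W = {Word w |w. sorted_wrt (letter_le k r) w \<and> set w \<subseteq> X}"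
  let ?E = "exponent_matrices k l r s"
  let ?c = "\<lambda>w. I +>\<^bsub>F\<^esub> Poly_Mapping.single w 1"
  let ?word = "\<lambda>m. Word (matrix_word k l r s m)"
  have I: "ideal I (free_algebra X)"
    unfolding I_def F_def X_def by (rule ideal_relations)
  have W: "W = ?word ` ?E"
    unfolding W_def X_def
    using sorted_matrix_word set_matrix_word by (fastforce elim!: matrix_word_surj)
  have separating: "\<exists>g. (\<forall>p\<in>I. pairing g p = 0) \<and> (\<forall>w'\<in>W. g w' = (if w' = w then 1 else 0))"
    if "w \<in> W" for w
  proof (intro exI conjI ballI)
    let ?g = "normal_form_coeff k r (mset (letters w))"
    show "pairing ?g p = 0" if "p \<in> I" for p
      using pairing_genideal[OF relations_closed, of k l r s ?g p] normal_form_coeff_relations that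
      unfolding I_def F_def X_def by blast
    show "?g w' = (if w' = w then 1 else 0)" if "w' \<in> W" for w'
    proof -
      have "w' = w" if "mset (letters w') = mset (letters w)"
        using sorted_wrt_mset_unique[of "letter_le k r" "letters w'" "letters w"] that \<open>w \<in> W\<close> \<open>w' \<in> W\<close>
          letter_le_antisym by (auto simp: W_def)
      then show ?thesis
        using \<open>w' \<in> W\<close> by (auto simp: W_def normal_form_coeff_sorted)
    qed
  qed
  have letters_W: "set (letters w) \<subseteq> X" if "w \<in> W" for w
    using that by (auto simp: W_def)
  have spanning: "\<exists>n. Poly_Mapping.keys n \<subseteq> W \<and> Poly_Mapping.single w 1 - n \<in> I"
    if "set (letters w) \<subseteq> X" for w
    using sorted_words_span[of "letters w" k l r s] that unfolding W_def I_def F_def X_def by simp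
  note basis = quotient_free_algebra_basis[OF I, of W, OF letters_W spanning separating, folded F_def]
  have t: "t_monomial k l r s m = ?c (?word m)" if "m \<in> ?E" for m
    using t_monomial_conv_word[OF that] unfolding I_def F_def X_def .
  have "inj_on (\<lambda>m. ?c (?word m)) ?E"
    using basis(1) inj_on_matrix_word[of k l r s] unfolding W
    by (auto simp: inj_on_def)
  then have "inj_on (t_monomial k l r s) ?E"
    using t by (simp cong: inj_on_cong)
  moreover have "{t_monomial k l r s m |m. m \<in> ?E} = ?c ` W"
    unfolding W using t by auto
  moreover have "M_alg k l r s = quotient_algebra F I"
    by (simp add: M_alg_def presented_algebra_def I_def F_def X_def)
  ultimately show ?thesis using basis(2) by simp
qed

end
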